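(* Let $G=\mathbb{Z}_{p^2}$, with $p$ a prime number. Then $$\theta(k,G)=\begin{cases} p(p-k+1), & 1\le k\le p;\\ p-\left[\frac kp\right]+1, & p\le k\le p^2.\end{cases}$$ Moreover, when $k<p^2-1$, there are equality cases for $(k,G)$ if and only if $\theta(k,G)<\theta(k-1,G)$ (with the convention $\theta(0,G)=+\infty$). They can be described as follows. (i) For all $k\le p$, equality cases are of the form $$f(px+x')=g(x)\,\mathbf{1}_{\{a\}}(x'),\qquad x,x'=0,\ldots,p-1,$$ with $g\in L(\mathbb{Z}_p)$ such that $|\operatorname{supp}(g)|=k$ and $|\operatorname{supp}(\widehat g)|=p-k+1$, and $a$ one of the values $0,\ldots,p-1$. (ii) For all $p\le k<p^2-1$, there are equality cases if and only if $k$ is divisible by $p$. For $k=pj$, equality cases are of the form $$f(px+x')=\chi(x)\,g(x'),\qquad x,x'=0,\ldots,p-1,$$ with $\chi$ a character of $\mathbb{Z}_p$ and $g\in L(\mathbb{Z}_p)$ such that $|\operatorname{supp}(g)|=j$ and $|\operatorname{supp}(\widehat g)|=p-j+1$.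
   Context: Notation: $\mathbb{Z}_n=\mathbb{Z}/n\mathbb{Z}$; $[\cdot]$ denotes the integer part; $\mathbf{1}_{\{a\}}$ is the characteristic function of the point $a$. For a finite Abelian group $G$, $L(G)$ is the space of complex functions on $G$, $\widehat G$ is the group of characters of $G$, and $\widehat f(\chi)=\sum_{x\in G}f(x)\chi(-x)$ for $f\in L(G)$, $\chi\in\widehat G$. For $1\le k\le|G|$, Meshulam's function is $$\theta(k,G)=\min\{\,|\operatorname{supp}\widehat f| : f\in L(G),\ f\ne0,\ |\operatorname{supp} f|\le k\}.$$ An equality case for $(k,G)$ is a nonzero function $f\in L(G)$ with $|\operatorname{supp} f|=k$ and $|\operatorname{supp}\widehat f|=\theta(k,G)$. Elements of $\mathbb{Z}_p$ (resp. $\mathbb{Z}_{p^2}$) are identified with their representatives in $[0,p)$ (resp. $[0,p^2)$), so every element of $\mathbb{Z}_{p^2}$ is uniquely $px+x'$ with $x,x'\in\{0,\ldots,p-1\}$.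
   Formalization: In (ii), the formal version has f(px+x')=ψ(px+x')g(x') with ψ a character of Z_{p²}, instead of χ(x)g(x') with χ a character of Z_p; the printed form fails, e.g. for p=3, k=6, g=(1,-1,0), χ(x)=e^{2πix/3}. *)

theory Defs
  imports
    "HOL-Analysis.Analysis"
    "HOL-Algebra.Elementary_Groups"
    "HOL-Computational_Algebra.Primes"
    "HOL-Library.Extended_Nat"
begin

text \<open>
  A function on a group \<open>G\<close> is an arbitrary \<open>'a \<Rightarrow> complex\<close>; only its values on \<open>carrier G\<close>
  matter below. Groups are written multiplicatively, following HOL-Algebra.
\<close>

definition supp :: "('a, 'm) monoid_scheme \<Rightarrow> ('a \<Rightarrow> complex) \<Rightarrow> 'a set" where
  "supp G f = {x \<in> carrier G. f x \<noteq> 0}"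

definition circle_group :: "complex monoid" where
  "circle_group = \<lparr>carrier = sphere 0 1, mult = (*), one = 1\<rparr>"

text \<open>Extensionality makes distinct elements of this set distinct as functions on \<open>carrier G\<close>,
  so that cardinalities of sets of characters are the intended ones.\<close>

definition characters :: "('a, 'm) monoid_scheme \<Rightarrow> ('a \<Rightarrow> complex) set" where
  "characters G = {\<psi> \<in> extensional (carrier G). \<psi> \<in> hom G circle_group}"

definition fourier ::
    "('a, 'm) monoid_scheme \<Rightarrow> ('a \<Rightarrow> complex) \<Rightarrow> ('a \<Rightarrow> complex) \<Rightarrow> complex" where
  "fourier G f \<psi> = (\<Sum>x\<in>carrier G. f x * \<psi> (inv\<^bsub>G\<^esub> x))"

definition fourier_supp ::
    "('a, 'm) monoid_scheme \<Rightarrow> ('a \<Rightarrow> complex) \<Rightarrow> ('a \<Rightarrow> complex) set" where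
  "fourier_supp G f = {\<psi> \<in> characters G. fourier G f \<psi> \<noteq> 0}"

text \<open>Meshulam's function. Over \<open>enat\<close> the infimum of a nonempty set is its minimum, and the
  infimum of the empty set is \<open>\<infinity>\<close>, so \<open>theta 0 G = \<infinity>\<close> when \<open>G\<close> is finite.
  The condition \<open>supp G f \<noteq> {}\<close> says that \<open>f\<close> is nonzero as a function on \<open>G\<close>.\<close>

definition theta :: "nat \<Rightarrow> ('a, 'm) monoid_scheme \<Rightarrow> enat" where
  "theta k G = Inf {enat (card (fourier_supp G f)) | f. supp G f \<noteq> {} \<and> card (supp G f) \<le> k}"

definition equality_case :: "nat \<Rightarrow> ('a, 'm) monoid_scheme \<Rightarrow> ('a \<Rightarrow> complex) \<Rightarrow> bool" where
  "equality_case k G f \<longleftrightarrow>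
     supp G f \<noteq> {} \<and> card (supp G f) = k \<and> enat (card (fourier_supp G f)) = theta k G"

end

theory Submission
  imports Defs
begin

text \<open>
  The key fact extends the uncertainty principle of Chebotarev and Tao: a nonzero combination of \<open>k\<close>
  powers of \<open>z\<close>, with exponents distinct modulo \<open>p\<close>, has fewer than \<open>k\<close> zeros among the roots of
  unity of order a power of \<open>p\<close>.

  Given \<open>f\<close> on \<open>\<int>/p\<^sup>2\<int>\<close>, let \<open>K\<close> and \<open>L\<close> be the sizes of the supports of \<open>f\<close> and of its transform,
  and \<open>s\<close> and \<open>t\<close> the numbers of residues modulo \<open>p\<close> that these supports meet. Applying the
  uncertainty principle on the cosets of \<open>p\<int>/p\<^sup>2\<int>\<close> gives \<open>K \<ge> s (p + 1 - t)\<close> and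
  \<open>L \<ge> t (p + 1 - s)\<close>. With \<open>v = p + 1 - t\<close> these add up to
  \<open>L + p K \<ge> p (p + 1) + (p + 1) (s - 1) (v - 1)\<close>, which contains Meshulam's bound. Near equality
  forces \<open>s = 1\<close> or \<open>v = 1\<close>. In the second case \<open>f\<close> has at most one point above each residue, so the key
  fact applies to \<open>f\<close> itself and leaves only \<open>s = 1\<close> or the exceptional value \<open>L = p\<^sup>2 - 1\<close>.
  Hence the equality cases with \<open>K \<le> p\<close> live on one coset; those with \<open>K \<ge> p\<close> follow by exchanging
  \<open>f\<close> and its transform.
\<close>

subsection \<open>Zeros of sparse exponential sums\<close>

text \<open>The inner binomial coefficients of a \<open>p\<close>-th power are divisible by
  \<open>p\<close>, and iterating \<open>e\<close> times preserves this. The error term is kept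
  inside the subring \<open>S\<close> because the intended case is \<int>[w] inside the complex
  field, where being a multiple of \<open>p\<close> would otherwise say nothing.\<close>

lemma subring_add_prime_power:
  fixes S :: "'a::comm_ring_1 set"
  assumes "prime p"
    and S: "1 \<in> S" "\<And>x y. x \<in> S \<Longrightarrow> y \<in> S \<Longrightarrow> x + y \<in> S"
      "\<And>x y. x \<in> S \<Longrightarrow> y \<in> S \<Longrightarrow> x - y \<in> S" "\<And>x y. x \<in> S \<Longrightarrow> y \<in> S \<Longrightarrow> x * y \<in> S"
    and xy: "x \<in> S" "y \<in> S"
  shows "\<exists>z\<in>S. (x + y) ^ (p ^ e) = x ^ (p ^ e) + y ^ (p ^ e) + of_nat p * z"
proof -
  have zero: "0 \<in> S" using S(3)[OF S(1) S(1)] by simp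
  have nat: "of_nat n \<in> S" for n by (induction n) (auto simp: zero S)
  have pow: "a ^ n \<in> S" if "a \<in> S" for a n by (induction n) (auto simp: that S)
  have sum: "sum f B \<in> S" if "\<And>i. i \<in> B \<Longrightarrow> f i \<in> S" for f :: "nat \<Rightarrow> 'a" and B
    using that by (induction B rule: infinite_finite_induct) (auto simp: zero S)
  have frob: "\<exists>z\<in>S. (a + b) ^ p = a ^ p + b ^ p + of_nat p * z" if "a \<in> S" "b \<in> S" for a b
  proof -
    have p: "p > 0" using assms by (simp add: prime_gt_0_nat)
    let ?z = "\<Sum>k\<in>{0<..<p}. of_nat ((p choose k) div p) * a ^ k * b ^ (p - k)"
    have "(a + b) ^ p = (\<Sum>k\<le>p. of_nat (p choose k) * a ^ k * b ^ (p - k))"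
      by (rule binomial_ring)
    also have "{..p} = insert 0 (insert p {0<..<p})"
      using p by auto
    also have "(\<Sum>k\<in>\<dots>. of_nat (p choose k) * a ^ k * b ^ (p - k)) =
        a ^ p + b ^ p + (\<Sum>k\<in>{0<..<p}. of_nat (p choose k) * a ^ k * b ^ (p - k))"
      using p by (subst sum.insert) auto
    also have "(\<Sum>k\<in>{0<..<p}. of_nat (p choose k) * a ^ k * b ^ (p - k)) = of_nat p * ?z"
      unfolding sum_distrib_left
    proof (rule sum.cong)
      fix k assume "k \<in> {0<..<p}"
      then have "p dvd p choose k"
        using assms by (intro dvd_choose_prime) auto
      then have "(of_nat (p choose k) :: 'a) = of_nat p * of_nat ((p choose k) div p)"
        by (metis dvd_mult_div_cancel of_nat_mult)
      then show "of_nat (p choose k) * a ^ k * b ^ (p - k) =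
          of_nat p * (of_nat ((p choose k) div p) * a ^ k * b ^ (p - k))"
        by (simp add: mult.assoc)
    qed simp
    finally show ?thesis
      using that by (intro bexI[of _ ?z]) (auto intro!: sum S nat pow)
  qed
  show ?thesis
  proof (induction e)
    case 0
    then show ?case using zero by (intro bexI[of _ 0]) auto
  next
    case (Suc e)
    let ?x = "x ^ (p ^ e)" and ?y = "y ^ (p ^ e)"
    from Suc obtain z where z: "z \<in> S" "(x + y) ^ (p ^ e) = ?x + ?y + of_nat p * z" by blast
    have mem: "?x \<in> S" "?y \<in> S" "of_nat p * z \<in> S" using xy z by (auto intro: S pow nat)
    obtain z1 where z1: "z1 \<in> S" "(?x + ?y) ^ p = ?x ^ p + ?y ^ p + of_nat p * z1"
      using frob[OF mem(1,2)] by blast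
    obtain z2 where z2: "z2 \<in> S"
      "(?x + ?y + of_nat p * z) ^ p = (?x + ?y) ^ p + (of_nat p * z) ^ p + of_nat p * z2"
      using frob[OF S(2)[OF mem(1,2)] mem(3)] by blast
    have pp: "p ^ Suc e = p ^ e * p" by simp
    have p1: "(of_nat p * z) ^ p = of_nat p * (z * (of_nat p * z) ^ (p - 1))"
      using assms(1) by (metis mult.assoc power_eq_if prime_gt_0_nat less_numeral_extra(3))
    have "(x + y) ^ (p ^ Suc e) = x ^ (p ^ Suc e) + y ^ (p ^ Suc e) +
        of_nat p * (z1 + (z * (of_nat p * z) ^ (p - 1) + z2))"
      unfolding pp power_mult z(2) z2(2) z1(2) p1 by (simp add: algebra_simps)
    moreover have "z1 + (z * (of_nat p * z) ^ (p - 1) + z2) \<in> S"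
      using z1 z2 z by (intro S pow nat)
    ultimately show ?case by blast
  qed
qed

text \<open>Fermat's little theorem iterated \<open>e\<close> times: additivity of the Frobenius
  power passes from \<open>a\<close> to \<open>a + 1\<close> and back, which reaches every integer
  from 0.\<close>

lemma prime_dvd_power_minus_self:
  fixes a :: int
  assumes "prime p"
  shows "int p dvd a ^ (p ^ e) - a"
proof -
  have add1: "\<exists>z. (x + 1) ^ (p ^ e) = x ^ (p ^ e) + 1 + int p * z" for x
    using subring_add_prime_power[OF assms, of UNIV x 1 e] by auto
  show ?thesis
  proof (induction a rule: int_induct[where k = 0])
    case base
    then show ?case using prime_gt_0_nat[OF assms] by (simp add: power_0_left)
  next
    case (step1 i)
    obtain z where "(i + 1) ^ (p ^ e) = i ^ (p ^ e) + 1 + int p * z"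
      using add1[of i] by blast
    then have "(i + 1) ^ (p ^ e) - (i + 1) = i ^ (p ^ e) - i + int p * z" by linarith
    with step1(2) show ?case by (metis dvd_add dvd_triv_left)
  next
    case (step2 i)
    obtain z where "(i - 1 + 1) ^ (p ^ e) = (i - 1) ^ (p ^ e) + 1 + int p * z"
      using add1[of "i - 1"] by blast
    then have "(i - 1) ^ (p ^ e) - (i - 1) = i ^ (p ^ e) - i - int p * z" by simp
    with step2(2) show ?case by (metis dvd_diff dvd_triv_left)
  qed
qed

text \<open>Gaussian elimination whose pivots stay nonzero because their reductions modulo \<open>p\<close> do.\<close>

lemma diagonal_mod_prime_imp_trivial_kernel:
  fixes R :: "'b::idom \<Rightarrow> int \<Rightarrow> bool"
  assumes "prime p"
    and diff: "\<And>x y m n. R x m \<Longrightarrow> R y n \<Longrightarrow> R (x - y) (m - n)"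
    and mult: "\<And>x y m n. R x m \<Longrightarrow> R y n \<Longrightarrow> R (x * y) (m * n)"
    and zero: "\<And>m. R 0 m \<Longrightarrow> int p dvd m"
    and "finite A"
    and "\<And>i j. i \<in> A \<Longrightarrow> j \<in> A \<Longrightarrow> R (W i j) (M i j)"
    and "\<And>i. i \<in> A \<Longrightarrow> \<not> int p dvd M i i"
    and "\<And>i j. i \<in> A \<Longrightarrow> j \<in> A \<Longrightarrow> i \<noteq> j \<Longrightarrow> int p dvd M i j"
    and "\<And>j. j \<in> A \<Longrightarrow> (\<Sum>i\<in>A. c i * W i j) = 0"
  shows "\<forall>i\<in>A. c i = 0"
  using assms(5-)
proof (induction A arbitrary: W M rule: finite_induct)
  case empty
  then show ?case by simp
next
  case (insert a A)
  note R = insert.prems(1) and diag = insert.prems(2) and off = insert.prems(3)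
    and eq = insert.prems(4)
  have p: "prime (int p)" using assms(1) by simp
  have c: "\<forall>i\<in>A. c i = 0"
  \<comment> \<open>Fraction-free elimination with pivot \<open>(a, a)\<close>. Applying the same
    formula to \<open>M\<close> keeps the relation \<open>R\<close> and the shape of
    \<open>M\<close> modulo \<open>p\<close>.\<close>
  proof (rule insert.IH[of "\<lambda>i j. W i j * W a a - W i a * W a j"
        "\<lambda>i j. M i j * M a a - M i a * M a j"])
    fix i j assume "i \<in> A" "j \<in> A"
    then show "R (W i j * W a a - W i a * W a j) (M i j * M a a - M i a * M a j)"
      by (intro diff mult R) auto
  next
    fix i assume i: "i \<in> A"
    then have "int p dvd M i a * M a i" "\<not> int p dvd M i i * M a a"
      using off[of i a] diag[of i] diag[of a] p insert.hyps by (auto simp: prime_dvd_mult_iff)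
    then show "\<not> int p dvd M i i * M a a - M i a * M a i"
      using dvd_add[of "int p" "M i i * M a a - M i a * M a i" "M i a * M a i"] by auto
  next
    fix i j assume "i \<in> A" "j \<in> A" "i \<noteq> j"
    then show "int p dvd M i j * M a a - M i a * M a j"
      using off[of i j] off[of i a] insert.hyps by (intro dvd_diff dvd_mult2) auto
  next
    fix j assume j: "j \<in> A"
    have s: "(\<Sum>i\<in>A. c i * W i k) = - c a * W a k" if "k \<in> insert a A" for k
      using eq[OF that] insert.hyps by (simp add: eq_neg_iff_add_eq_0 add.commute)
    have "(\<Sum>i\<in>A. c i * (W i j * W a a - W i a * W a j)) =
       (\<Sum>i\<in>A. c i * W i j) * W a a - (\<Sum>i\<in>A. c i * W i a) * W a j"
      by (simp add: sum_distrib_right sum_subtractf right_diff_distrib mult.assoc)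
    also have "\<dots> = 0" using s[of j] s[of a] j by simp
    finally show "(\<Sum>i\<in>A. c i * (W i j * W a a - W i a * W a j)) = 0" .
  qed
  moreover have "c a * W a a = 0"
    using eq[of a] c insert.hyps by simp
  moreover have "W a a \<noteq> 0"
    using R[of a a] zero diag[of a] by auto
  ultimately show ?case by simp
qed

section \<open>The reduction of \<int>[w] modulo \<open>p\<close> that sends \<open>w\<close> to
  1\<close>

text \<open>The pairs \<open>(P(w), P(1))\<close> for integer polynomials \<open>P\<close>.\<close>

inductive reduces_to :: "complex \<Rightarrow> complex \<Rightarrow> int \<Rightarrow> bool" for w where
  const: "reduces_to w (of_int m) m"
| root: "reduces_to w w 1"
| add: "reduces_to w x m \<Longrightarrow> reduces_to w y n \<Longrightarrow> reduces_to w (x + y) (m + n)"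
| mult: "reduces_to w x m \<Longrightarrow> reduces_to w y n \<Longrightarrow> reduces_to w (x * y) (m * n)"

lemma reduces_to_diff:
  "reduces_to w x m \<Longrightarrow> reduces_to w y n \<Longrightarrow> reduces_to w (x - y) (m - n)"
  using add[of w x m "of_int (-1) * y" "(-1) * n"] mult[OF const[of w "-1"], of y n] by simp

lemma reduces_to_sum:
  "(\<And>i. i \<in> A \<Longrightarrow> reduces_to w (f i) (g i)) \<Longrightarrow> reduces_to w (sum f A) (sum g A)"
  by (induction A rule: infinite_finite_induct) (use const[of w 0] in \<open>simp_all add: add\<close>)

lemma reduces_to_power: "reduces_to w x m \<Longrightarrow> reduces_to w (x ^ k) (m ^ k)"
  by (induction k) (use const[of w 1] in \<open>simp_all add: mult\<close>)

text \<open>Modulo \<open>p\<close>, raising \<open>P(w)\<close> to the power \<open>p ^ e\<close>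
  gives \<open>P(w ^ (p ^ e)) = P(1)\<close>. The induction follows the construction of
  \<open>x\<close> as a polynomial expression in \<open>w\<close>.\<close>

lemma reduces_to_frobenius:
  assumes "prime p" "w ^ (p ^ e) = 1" "reduces_to w x m"
  shows "\<exists>y n. reduces_to w y n \<and> x ^ (p ^ e) = of_int m + of_nat p * y"
  using assms(3)
proof (induction rule: reduces_to.induct)
  case (const m)
  obtain k where "m ^ (p ^ e) - m = int p * k"
    using prime_dvd_power_minus_self[OF assms(1), of m e] by (auto elim: dvdE)
  then have "of_int (m ^ (p ^ e)) = (of_int (m + int p * k) :: complex)"
    by (simp add: algebra_simps)
  then show ?case
    by (intro exI[of _ "of_int k"] exI[of _ k]) (auto intro: reduces_to.const)
next
  case root
  then show ?case
    using assms(2) reduces_to.const[of w 0] by (intro exI[of _ 0]) auto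
next
  case (add x m y n)
  then obtain x' m' y' n' where *: "reduces_to w x' m'" "x ^ (p ^ e) = of_int m + of_nat p * x'"
    "reduces_to w y' n'" "y ^ (p ^ e) = of_int n + of_nat p * y'" by blast
  \<comment> \<open>The elements with some reduction form the subring \<int>[w], so the error term
    of the Frobenius congruence has a reduction too.\<close>
  have "\<exists>z\<in>{x. \<exists>m. reduces_to w x m}.
      (x + y) ^ (p ^ e) = x ^ (p ^ e) + y ^ (p ^ e) + of_nat p * z"
  proof (rule subring_add_prime_power[OF assms(1)])
    show "1 \<in> {x. \<exists>m. reduces_to w x m}"
      using reduces_to.const[of w 1] by auto
  qed (use add.hyps reduces_to.add reduces_to_diff reduces_to.mult in \<open>blast+\<close>)
  then obtain z l where z: "reduces_to w z l"
    "(x + y) ^ (p ^ e) = x ^ (p ^ e) + y ^ (p ^ e) + of_nat p * z" by blast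
  have "(x + y) ^ (p ^ e) = of_int (m + n) + of_nat p * (x' + y' + z)"
    unfolding z(2) * by (simp add: algebra_simps)
  then show ?case
    using reduces_to.add[OF reduces_to.add[OF *(1,3)] z(1)] by blast
next
  case (mult x m y n)
  then obtain x' m' y' n' where *: "reduces_to w x' m'" "x ^ (p ^ e) = of_int m + of_nat p * x'"
    "reduces_to w y' n'" "y ^ (p ^ e) = of_int n + of_nat p * y'" by blast
  have "(x * y) ^ (p ^ e) = of_int (m * n) + of_nat p * (x' * y ^ (p ^ e) + of_int m * y')"
    unfolding power_mult_distrib * by (simp add: algebra_simps)
  then show ?case
    using reduces_to.add[OF reduces_to.mult[OF *(1) reduces_to_power[OF mult.hyps(2)]]
        reduces_to.mult[OF reduces_to.const *(3)]] by blast
qed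

text \<open>For \<open>w ^ N = 1\<close> this is \<int>[w], presented by finitely many generators so
  that multiplication by a ring element becomes an integer matrix. The generators need not be
  independent.\<close>

definition root_lattice :: "nat \<Rightarrow> complex \<Rightarrow> complex set" where
  "root_lattice N w = {x. \<exists>q :: nat \<Rightarrow> int. x = (\<Sum>i<N. of_int (q i) * w ^ i)}"

lemma root_lattice_add:
  assumes "x \<in> root_lattice N w" "y \<in> root_lattice N w"
  shows "x + y \<in> root_lattice N w"
proof -
  from assms obtain q r :: "nat \<Rightarrow> int" where "x = (\<Sum>i<N. of_int (q i) * w ^ i)"
    "y = (\<Sum>i<N. of_int (r i) * w ^ i)"
    by (auto simp: root_lattice_def)
  then have "x + y = (\<Sum>i<N. of_int (q i + r i) * w ^ i)"
    by (simp add: algebra_simps sum.distrib)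
  then show ?thesis unfolding root_lattice_def by (intro CollectI exI)
qed

lemma root_lattice_scale:
  assumes "x \<in> root_lattice N w"
  shows "of_int m * x \<in> root_lattice N w"
proof -
  from assms obtain q :: "nat \<Rightarrow> int" where "x = (\<Sum>i<N. of_int (q i) * w ^ i)"
    by (auto simp: root_lattice_def)
  then have "of_int m * x = (\<Sum>i<N. of_int (m * q i) * w ^ i)"
    by (simp add: sum_distrib_left mult.assoc)
  then show ?thesis unfolding root_lattice_def by (intro CollectI exI)
qed

lemma root_lattice_sum:
  "(\<And>i. i \<in> A \<Longrightarrow> f i \<in> root_lattice N w) \<Longrightarrow> sum f A \<in> root_lattice N w"
proof (induction A rule: infinite_finite_induct)
  have zero: "0 \<in> root_lattice N w"
    unfolding root_lattice_def by (intro CollectI exI[of _ "\<lambda>_. 0"]) simp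
  {
    case infinite
    then show ?case using zero by simp
  next
    case empty
    then show ?case using zero by simp
  }
next
  case (insert x F)
  then show ?case by (simp add: root_lattice_add)
qed

lemma root_lattice_power:
  assumes "w ^ N = 1" "N > 0"
  shows "w ^ k \<in> root_lattice N w"
proof -
  have "w ^ k = w ^ (k mod N)"
    by (metis assms(1) mod_mult_div_eq mult.right_neutral power_add power_mult power_one)
  also have "\<dots> = (\<Sum>i<N. of_int (if i = k mod N then 1 else 0) * w ^ i)"
    using assms(2) by (simp add: if_distrib[of of_int] if_distrib[of "\<lambda>x. x * _"] cong: if_cong)
  finally show ?thesis unfolding root_lattice_def by (intro CollectI exI)
qed

text \<open>Multiplication by \<open>w\<close> shifts the exponents, and \<open>w ^ N = 1\<close>
  brings the last one back into range; sums and products follow by induction.\<close>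

lemma reduces_to_mult_root_lattice:
  assumes "w ^ N = 1" "N > 0" "reduces_to w x m" "y \<in> root_lattice N w"
  shows "x * y \<in> root_lattice N w"
  using assms(3,4)
proof (induction arbitrary: y rule: reduces_to.induct)
  case root
  then obtain q :: "nat \<Rightarrow> int" where "y = (\<Sum>i<N. of_int (q i) * w ^ i)"
    by (auto simp: root_lattice_def)
  then have "w * y = (\<Sum>i<N. of_int (q i) * w ^ Suc i)"
    by (simp add: sum_distrib_left mult.left_commute)
  also have "\<dots> \<in> root_lattice N w"
    by (intro root_lattice_sum root_lattice_scale root_lattice_power assms)
  finally show ?case .
qed (auto simp: distrib_right mult.assoc root_lattice_add root_lattice_scale)

text \<open>If \<open>p\<close> were invertible in \<open>\<int>[w]\<close>, then the lattice \<open>L = \<int>[w]\<close> would satisfy \<open>L = p L\<close>,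
  hence be zero.\<close>

lemma reduces_to_prime_mult_neq_1:
  assumes "prime p" "w ^ N = 1" "N > 0" "reduces_to w y n"
  shows "of_nat p * y \<noteq> 1"
proof
  assume y: "of_nat p * y = 1"
  have "\<exists>q :: nat \<Rightarrow> int. y * w ^ j = (\<Sum>i<N. of_int (q i) * w ^ i)" for j
    using reduces_to_mult_root_lattice[OF assms(2-4) root_lattice_power[OF assms(2,3)], of j]
    by (auto simp: root_lattice_def)
  then obtain q :: "nat \<Rightarrow> nat \<Rightarrow> int" where q: "y * w ^ j = (\<Sum>i<N. of_int (q j i) * w ^ i)" for j
    by metis
  \<comment> \<open>Expanding \<open>w ^ j = p * (y * w ^ j)\<close> in the generators shows that
    this matrix kills the vector of the powers \<open>w ^ i\<close>. It is the identity modulo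
    \<open>p\<close>, so all these powers vanish, including \<open>w ^ 0\<close>.\<close>
  let ?M = "\<lambda>i j. (if i = j then 1 else 0) - int p * q j i"
  have p: "\<not> int p dvd 1" using assms(1) by auto
  have "\<forall>i\<in>{..<N}. w ^ i = 0"
  proof (rule diagonal_mod_prime_imp_trivial_kernel[where R = "\<lambda>x m. x = of_int m" and M = ?M
        and W = "\<lambda>i j. of_int (?M i j)", OF assms(1)])
    fix j assume "j \<in> {..<N}"
    then have "(\<Sum>i<N. w ^ i * of_int (?M i j)) = w ^ j - of_nat p * (\<Sum>i<N. of_int (q j i) * w ^ i)"
      by (simp add: right_diff_distrib sum_subtractf sum_distrib_left if_distrib[of of_int]
          if_distrib[of "\<lambda>x. _ * x"] mult_ac cong: if_cong)
    also have "\<dots> = 0" unfolding q[symmetric] using y by (simp flip: mult.assoc)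
    finally show "(\<Sum>i<N. w ^ i * of_int (?M i j)) = 0" .
  next
    fix i assume "i \<in> {..<N}"
    have "\<not> int p dvd 1 - int p * q i i"
      using p dvd_add[of "int p" "1 - int p * q i i" "int p * q i i"] by auto
    then show "\<not> int p dvd ?M i i" by simp
  qed auto
  then show False using assms(3) by (metis lessThan_iff power_0 zero_neq_one)
qed

text \<open>Well-definedness of the reduction modulo \<open>p\<close>: by Frobenius,
  \<open>m\<close> lies in \<open>p\<close> times \<int>[w]. If \<open>p\<close> did not divide
  \<open>m\<close>, Bezout would put 1 there as well.\<close>

lemma reduces_to_zero_imp_dvd:
  assumes "prime p" "w ^ (p ^ e) = 1" "reduces_to w 0 m"
  shows "int p dvd m"
proof (rule ccontr)
  assume "\<not> int p dvd m"
  then have "coprime (int p) m" using assms(1) by (simp add: prime_imp_coprime)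
  then obtain u v where uv: "u * int p + v * m = 1"
    using bezout_int[of "int p" m] by auto
  have p: "p > 0" using assms(1) by (simp add: prime_gt_0_nat)
  have "(0 :: complex) ^ (p ^ e) = 0" using p by simp
  then obtain y n where y: "reduces_to w y n" "of_int m = - (of_nat p * y)"
    using reduces_to_frobenius[OF assms] by (metis eq_neg_iff_add_eq_0)
  have "of_nat p * (of_int u - of_int v * y) = of_int (u * int p + v * m)"
    by (simp add: y(2) algebra_simps)
  moreover have "reduces_to w (of_int u - of_int v * y) (u - v * n)"
    by (intro reduces_to_diff reduces_to.intros y)
  ultimately show False
    using reduces_to_prime_mult_neq_1[OF assms(1,2)] p uv by auto
qed

section \<open>Divided differences of monomials\<close>

text \<open>The divided difference of the monomial \<open>t ^ a\<close> at the listed nodes, that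
  is, the complete homogeneous symmetric polynomial of degree \<open>a - (length zs - 1)\<close>.
  The recursion expands \<open>(t ^ a - z ^ a) / (t - z)\<close>, which avoids denominators and so
  stays in \<int>[w].\<close>

fun div_diff :: "complex list \<Rightarrow> nat \<Rightarrow> complex" where
  "div_diff [] a = 0"
| "div_diff [z] a = z ^ a"
| "div_diff (z # y # zs) a = (\<Sum>i<a. z ^ (a - Suc i) * div_diff (y # zs) i)"

text \<open>With every node reduced to 1, the recursion turns into the hockey-stick summation of
  binomial coefficients.\<close>

lemma reduces_to_div_diff:
  assumes "zs \<noteq> []" "\<forall>z\<in>set zs. reduces_to w z 1"
  shows "reduces_to w (div_diff zs a) (int (a choose (length zs - 1)))"
  using assms
proof (induction zs a rule: div_diff.induct)
  case (2 z a)
  then show ?case using reduces_to_power[of w z 1 a] by simp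
next
  case (3 z y zs a)
  have "reduces_to w (\<Sum>i<a. z ^ (a - Suc i) * div_diff (y # zs) i)
     (\<Sum>i<a. 1 ^ (a - Suc i) * int (i choose length zs))"
    using 3 by (intro reduces_to_sum reduces_to.mult reduces_to_power) auto
  moreover have "(\<Sum>i<a. i choose length zs) = a choose Suc (length zs)"
  proof (cases a)
    case (Suc b)
    then show ?thesis using sum_choose_upper[of "length zs" b] by (simp add: lessThan_Suc_atMost)
  qed simp
  ultimately show ?case by (simp flip: of_nat_sum)
qed simp

text \<open>Dividing a polynomial by \<open>t - z\<close> at a zero \<open>z\<close> leaves a
  quotient that still vanishes at the other nodes, to which the induction hypothesis
  applies.\<close>

lemma sum_mult_div_diff_eq_0:
  assumes "zs \<noteq> []" "distinct zs" "\<And>z. z \<in> set zs \<Longrightarrow> (\<Sum>a<n. c a * z ^ a) = 0"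
  shows "(\<Sum>a<n. c a * div_diff zs a) = 0"
  using assms
proof (induction zs arbitrary: c rule: induct_list012)
  case (3 z y zs)
  \<comment> \<open>The coefficients of the quotient by \<open>t - z\<close>.\<close>
  define c' where "c' i = (\<Sum>a\<in>{i<..<n}. c a * z ^ (a - Suc i))" for i
  have swap: "(\<Sum>i<n. c' i * h i) = (\<Sum>a<n. c a * (\<Sum>i<a. z ^ (a - Suc i) * h i))" for h
  proof -
    have "(\<Sum>i<n. c' i * h i) = (\<Sum>i<n. \<Sum>a\<in>{i<..<n}. c a * (z ^ (a - Suc i) * h i))"
      by (simp add: c'_def sum_distrib_right mult.assoc)
    also have "\<dots> = (\<Sum>a<n. \<Sum>i<a. c a * (z ^ (a - Suc i) * h i))"
      unfolding sum.Sigma[OF finite_lessThan ballI[OF finite_lessThan]]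
        sum.Sigma[OF finite_lessThan ballI[OF finite_greaterThanLessThan]]
      by (rule sum.reindex_bij_witness[of _ "\<lambda>(a, i). (i, a)" "\<lambda>(i, a). (a, i)"]) auto
    finally show ?thesis by (simp add: sum_distrib_left)
  qed
  have "(\<Sum>i<n. c' i * x ^ i) = 0" if "x \<in> set (y # zs)" for x
  proof -
    have "x \<noteq> z" using that 3 by auto
    have "(x - z) * (\<Sum>i<n. c' i * x ^ i) =
        (\<Sum>a<n. c a * ((x - z) * (\<Sum>i<a. z ^ (a - Suc i) * x ^ i)))"
      unfolding swap by (simp add: sum_distrib_left mult_ac)
    also have "\<dots> = (\<Sum>a<n. c a * x ^ a) - (\<Sum>a<n. c a * z ^ a)"
      by (simp add: right_diff_distrib sum_subtractf flip: power_diff_sumr2)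
    also have "\<dots> = 0" using 3 that by simp
    finally show ?thesis using \<open>x \<noteq> z\<close> by simp
  qed
  then have "(\<Sum>i<n. c' i * div_diff (y # zs) i) = 0"
    using 3 by (intro "3.IH") auto
  then show ?case by (simp add: swap)
qed auto

text \<open>Multiplying a binomial coefficient by \<open>x - m\<close> gives an integer combination
  of it and the next one. Integrality of \<open>u\<close> is the point: it lets Lagrange products be
  formed from the binomial reductions of divided differences without dividing by factorials.\<close>

lemma prod_diff_eq_sum_binomial:
  assumes "finite M"
  shows "\<exists>u :: nat \<Rightarrow> int. \<forall>x :: nat.
    (\<Prod>m\<in>M. int x - int m) = (\<Sum>j\<le>card M. u j * int (x choose j))"
  using assms
proof (induction M rule: finite_induct)
  case empty
  show ?case by (intro exI[of _ "\<lambda>_. 1"]) simp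
next
  case (insert m M)
  then obtain u :: "nat \<Rightarrow> int" where u:
    "(\<Prod>m\<in>M. int x - int m) = (\<Sum>j\<le>card M. u j * int (x choose j))" for x by blast
  let ?k = "card M"
  \<comment> \<open>Read off from \<open>(x - m) * (x choose j) = (j + 1) * (x choose (j + 1)) + (j
    - m) * (x choose j)\<close>.\<close>
  define u' where "u' j = (if j = 0 then 0 else int j * u (j - 1)) +
    (if j \<le> ?k then (int j - int m) * u j else 0)" for j
  have absorb: "int x * int (x choose j) = int (Suc j) * int (x choose Suc j) + int j * int (x choose j)"
    for x j
  proof (cases "j \<le> x")
    case True
    then have "(x - j) * (x choose j) = Suc j * (x choose Suc j)"
      by (metis binomial_absorb_comp binomial_absorption)
    then have "int (x - j) * int (x choose j) = int (Suc j) * int (x choose Suc j)"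
      by (metis of_nat_mult)
    then show ?thesis using True by (simp add: of_nat_diff algebra_simps)
  qed (simp add: binomial_eq_0)
  have "(\<Prod>m\<in>insert m M. int x - int m) = (\<Sum>j\<le>card (insert m M). u' j * int (x choose j))" for x
  proof -
    have "(\<Prod>m\<in>insert m M. int x - int m) = (\<Sum>j\<le>?k. u j * ((int x - int m) * int (x choose j)))"
      using insert.hyps by (simp add: u sum_distrib_left mult_ac)
    also have "\<dots> = (\<Sum>j\<le>?k. int (Suc j) * u j * int (x choose Suc j)) +
        (\<Sum>j\<le>?k. (int j - int m) * u j * int (x choose j))"
      unfolding left_diff_distrib absorb sum.distrib[symmetric]
      by (intro sum.cong) (auto simp: algebra_simps)
    also have "(\<Sum>j\<le>?k. int (Suc j) * u j * int (x choose Suc j)) =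
        (\<Sum>j\<le>Suc ?k. (if j = 0 then 0 else int j * u (j - 1)) * int (x choose j))"
      by (simp only: sum.atMost_Suc_shift) simp
    also have "(\<Sum>j\<le>?k. (int j - int m) * u j * int (x choose j)) =
        (\<Sum>j\<le>Suc ?k. (if j \<le> ?k then (int j - int m) * u j else 0) * int (x choose j))"
      by simp
    finally show ?thesis
      by (simp only: u'_def distrib_right sum.distrib card_insert_disjoint[OF insert.hyps])
  qed
  then show ?case by blast
qed

text \<open>Divided differences at the zeros remove the factors vanishing modulo \<open>1 - w\<close>: they reduce to
  binomial coefficients, which Lagrange interpolation over the exponents turns into a matrix that is
  diagonal modulo \<open>p\<close>.\<close>

lemma sparse_vanishing_imp_zero:
  fixes w :: complex
  assumes "prime p" "w ^ (p ^ e) = 1"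
    and A: "finite A" "inj_on (\<lambda>a. a mod p) A"
    and Z: "finite Z" "Z \<subseteq> range (\<lambda>k. w ^ k)" "card A \<le> card Z"
    and vanish: "\<And>z. z \<in> Z \<Longrightarrow> (\<Sum>a\<in>A. c a * z ^ a) = 0"
  shows "\<forall>a\<in>A. c a = 0"
proof -
  obtain zs where zs: "set zs = Z" "distinct zs"
    using finite_distinct_list[OF Z(1)] by blast
  have len: "length zs \<ge> card A" using zs Z(3) distinct_card by fastforce
  \<comment> \<open>The first \<open>j + 1\<close> zeros, whose divided difference of
    \<open>t ^ a\<close> reduces to \<open>a choose j\<close>.\<close>
  define s where "s j = take (Suc j) zs" for j
  have s: "s j \<noteq> []" "distinct (s j)" "set (s j) \<subseteq> Z" "length (s j) - 1 = j" if "j < card A" for j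
    using that len zs by (auto simp: s_def dest: in_set_takeD)
  obtain n where n: "A \<subseteq> {..<n}" using A(1) finite_nat_bounded by blast
  have extend: "(\<Sum>a\<in>A. c a * h a) = (\<Sum>a<n. (if a \<in> A then c a else 0) * h a)" for h
    using n by (intro sum.mono_neutral_cong_left) auto
  have dd: "(\<Sum>a\<in>A. c a * div_diff (s j) a) = 0" if "j < card A" for j
    unfolding extend
  proof (rule sum_mult_div_diff_eq_0)
    fix z assume "z \<in> set (s j)"
    then have "z \<in> Z" using s(3)[OF that] by blast
    from vanish[OF this] show "(\<Sum>a<n. (if a \<in> A then c a else 0) * z ^ a) = 0"
      by (simp add: extend)
  qed (use s that in auto)
  have red: "reduces_to w (div_diff (s j) a) (int (a choose j))" if "j < card A" for j a
  proof -
    have "\<forall>z\<in>set (s j). reduces_to w z 1"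
      using s(3)[OF that] Z(2) reduces_to_power[OF reduces_to.root, of w] by fastforce
    from reduces_to_div_diff[OF s(1)[OF that] this, of a] s(4)[OF that] show ?thesis by simp
  qed
  \<comment> \<open>The product is the Lagrange numerator at the exponent \<open>m\<close>: on
    \<open>A\<close> it vanishes except at \<open>m\<close>, where it is prime to \<open>p\<close>
    because the exponents are distinct modulo \<open>p\<close>.\<close>
  have "\<exists>u :: nat \<Rightarrow> int. \<forall>a :: nat.
      (\<Prod>m'\<in>A - {m}. int a - int m') = (\<Sum>j<card A. u j * int (a choose j))" if "m \<in> A" for m
  proof -
    have "Suc (card (A - {m})) = card A" using A(1) that by (rule card_Suc_Diff1)
    then have "{..card (A - {m})} = {..<card A}" by (metis lessThan_Suc_atMost)
    then show ?thesis using prod_diff_eq_sum_binomial[of "A - {m}"] A(1) by simp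
  qed
  then obtain u :: "nat \<Rightarrow> nat \<Rightarrow> int" where u: "(\<Prod>m'\<in>A - {m}. int a - int m') =
      (\<Sum>j<card A. u m j * int (a choose j))" if "m \<in> A" for m a
    by metis
  show ?thesis
  proof (rule diagonal_mod_prime_imp_trivial_kernel[OF assms(1), where R = "reduces_to w"
        and W = "\<lambda>a m. \<Sum>j<card A. of_int (u m j) * div_diff (s j) a"
        and M = "\<lambda>a m. \<Prod>m'\<in>A - {m}. int a - int m'"])
    fix a m assume "a \<in> A" "m \<in> A"
    show "reduces_to w (\<Sum>j<card A. of_int (u m j) * div_diff (s j) a) (\<Prod>m'\<in>A - {m}. int a - int m')"
      unfolding u[OF \<open>m \<in> A\<close>]
      by (intro reduces_to_sum reduces_to.mult reduces_to.const red) auto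
  next
    fix a assume a: "a \<in> A"
    show "\<not> int p dvd (\<Prod>m'\<in>A - {a}. int a - int m')"
    proof
      assume "int p dvd (\<Prod>m'\<in>A - {a}. int a - int m')"
      then obtain m where m: "m \<in> A - {a}" "int p dvd int a - int m"
        using assms(1) A(1) by (auto simp: prime_dvd_prod_iff)
      then have "a mod p = m mod p"
        by (metis mod_eq_dvd_iff of_nat_eq_iff of_nat_mod)
      with m a A(2) show False by (auto simp: inj_on_def)
    qed
  next
    fix a m assume "a \<in> A" "m \<in> A" "a \<noteq> m"
    then have "(\<Prod>m'\<in>A - {m}. int a - int m') = 0" using A(1) by (intro prod_zero) auto
    then show "int p dvd (\<Prod>m'\<in>A - {m}. int a - int m')" by simp
  next
    fix m assume "m \<in> A"
    have "(\<Sum>a\<in>A. c a * (\<Sum>j<card A. of_int (u m j) * div_diff (s j) a)) =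
        (\<Sum>j<card A. of_int (u m j) * (\<Sum>a\<in>A. c a * div_diff (s j) a))"
      unfolding sum_distrib_left by (subst sum.swap) (simp add: mult_ac)
    then show "(\<Sum>a\<in>A. c a * (\<Sum>j<card A. of_int (u m j) * div_diff (s j) a)) = 0"
      by (simp add: dd)
  qed (use A assms reduces_to_diff reduces_to.mult reduces_to_zero_imp_dvd in blast)+
qed

subsection \<open>The discrete Fourier transform\<close>

definition primroot :: "nat \<Rightarrow> complex \<Rightarrow> bool" where
  "primroot n w \<longleftrightarrow> n > 0 \<and> w ^ n = 1 \<and> inj_on (\<lambda>k. w ^ k) {..<n}"

text \<open>The root is a parameter so that the inverse transform (\<open>inverse w\<close>) and the
  transform on the subgroup of order \<open>p\<close> (\<open>w ^ p\<close>) are instances. The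
  frequency may be any natural number, and the transform is unnormalised.\<close>

definition dft :: "nat \<Rightarrow> complex \<Rightarrow> (nat \<Rightarrow> complex) \<Rightarrow> nat \<Rightarrow> complex" where
  "dft n w f k = (\<Sum>x<n. f x * w ^ (x * k))"

definition nonzeros :: "nat \<Rightarrow> (nat \<Rightarrow> complex) \<Rightarrow> nat set" where
  "nonzeros n f = {x. x < n \<and> f x \<noteq> 0}"

lemma finite_nonzeros [simp]: "finite (nonzeros n f)"
  by (simp add: nonzeros_def)

lemma card_nonzeros_le: "card (nonzeros n f) \<le> n"
  using card_mono[of "{..<n}" "nonzeros n f"] by (auto simp: nonzeros_def)

lemma nonzeros_cong: "(\<And>x. x < n \<Longrightarrow> f x = 0 \<longleftrightarrow> g x = 0) \<Longrightarrow> nonzeros n f = nonzeros n g"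
  by (auto simp: nonzeros_def)

lemma dft_cong: "(\<And>x. x < n \<Longrightarrow> f x = g x) \<Longrightarrow> dft n w f k = dft n w g k"
  by (simp add: dft_def)

lemma dft_mult: "dft n w (\<lambda>x. c * f x) k = c * dft n w f k"
  by (simp add: dft_def sum_distrib_left mult.assoc)

lemma primroot_power_mod:
  assumes "primroot n w"
  shows "w ^ (k mod n) = w ^ k"
proof -
  have "w ^ k = w ^ (k mod n + n * (k div n))" by simp
  also have "\<dots> = w ^ (k mod n)" using assms by (simp only: power_add power_mult) (simp add: primroot_def)
  finally show ?thesis by simp
qed

lemma primroot_power_eq_iff:
  assumes "primroot n w"
  shows "w ^ i = w ^ j \<longleftrightarrow> i mod n = j mod n"
proof -
  have "w ^ i = w ^ j \<longleftrightarrow> w ^ (i mod n) = w ^ (j mod n)"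
    using assms by (simp add: primroot_power_mod)
  also have "\<dots> \<longleftrightarrow> i mod n = j mod n"
    using assms inj_on_eq_iff[of "\<lambda>k. w ^ k" "{..<n}" "i mod n" "j mod n"]
    by (auto simp: primroot_def)
  finally show ?thesis .
qed

lemma primroot_inverse: "primroot n w \<Longrightarrow> primroot n (inverse w)"
  by (simp add: primroot_def power_inverse inj_on_def)

lemma primroot_nonzero: "primroot n w \<Longrightarrow> w \<noteq> 0"
  by (auto simp: primroot_def power_0_left)

lemma primroot_power:
  assumes "primroot (m * n) w"
  shows "primroot n (w ^ m)"
proof -
  have "inj_on (\<lambda>k. w ^ (m * k)) {..<n}"
  proof (rule inj_onI)
    fix i j assume ij: "i \<in> {..<n}" "j \<in> {..<n}" "w ^ (m * i) = w ^ (m * j)"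
    have "m > 0" using assms by (simp add: primroot_def)
    with ij show "i = j"
      using primroot_power_eq_iff[OF assms, of "m * i" "m * j"] by simp
  qed
  then show ?thesis
    using assms by (simp add: primroot_def flip: power_mult)
qed

lemma primroot_cis: "n > 0 \<Longrightarrow> primroot n (cis (2 * pi / n))"
  using Complex.bij_betw_roots_unity[of n]
  by (simp add: primroot_def Complex.DeMoivre bij_betw_def mult_ac cis_2pi[unfolded mult.commute[of 2 pi]])

lemma dft_mod:
  assumes "primroot n w"
  shows "dft n w f (k mod n) = dft n w f k"
  unfolding dft_def
  by (intro sum.cong refl arg_cong2[of _ _ _ _ "(*)"])
    (simp add: primroot_power_eq_iff[OF assms] mod_mult_right_eq)

lemma dft_inversion:
  assumes "primroot n w" "x < n"
  shows "dft n (inverse w) (dft n w f) x = of_nat n * f x"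
proof -
  note w0 = primroot_nonzero[OF assms(1)]
  have orth: "(\<Sum>k<n. (w ^ y * inverse w ^ x) ^ k) = (if y = x then of_nat n else 0)" if "y < n" for y
  proof (cases "y = x")
    case True
    then show ?thesis using w0 by (simp add: power_inverse)
  next
    case False
    let ?u = "w ^ y * inverse w ^ x"
    have "w ^ y \<noteq> w ^ x"
      using primroot_power_eq_iff[OF assms(1), of y x] assms(2) that False by simp
    then have "?u \<noteq> 1" using w0 by (auto simp: field_simps power_inverse)
    moreover have "?u ^ n = (w ^ n) ^ y * inverse ((w ^ n) ^ x)"
      by (simp add: power_mult_distrib power_inverse mult.commute flip: power_mult)
    then have "?u ^ n = 1" using assms(1) by (simp add: primroot_def)
    ultimately show ?thesis using False by (simp add: geometric_sum)
  qed
  have "dft n (inverse w) (dft n w f) x =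
      (\<Sum>k<n. \<Sum>y<n. f y * (w ^ y * inverse w ^ x) ^ k)"
    by (simp add: dft_def sum_distrib_left power_mult_distrib mult_ac flip: power_mult)
  also have "\<dots> = (\<Sum>y<n. f y * (\<Sum>k<n. (w ^ y * inverse w ^ x) ^ k))"
    unfolding sum_distrib_left by (rule sum.swap)
  also have "\<dots> = (\<Sum>y<n. if y = x then of_nat n * f x else 0)"
    by (intro sum.cong) (auto simp: orth)
  finally show ?thesis using assms(2) by simp
qed

lemma nonzeros_dft_inversion:
  assumes "primroot n w"
  shows "nonzeros n (dft n (inverse w) (dft n w f)) = nonzeros n f"
  using assms by (intro nonzeros_cong) (simp add: dft_inversion primroot_def)

lemma nonzeros_dft_empty_iff:
  assumes "primroot n w"
  shows "nonzeros n (dft n w f) = {} \<longleftrightarrow> nonzeros n f = {}"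
proof -
  have "nonzeros n (dft n u g) = {}" if "nonzeros n g = {}" for u g
    using that by (auto simp: nonzeros_def dft_def)
  then show ?thesis using nonzeros_dft_inversion[OF assms, of f] by metis
qed

section \<open>Uncertainty principles\<close>

text \<open>A frequency \<open>k\<close> with vanishing transform is a zero \<open>w ^ k\<close> of
  the polynomial with coefficients \<open>f\<close>. If the bound failed, there would be at least as
  many such zeros as terms, which forces the polynomial to be zero.\<close>

lemma uncertainty_distinct_residues:
  assumes "prime p" "primroot (p ^ e) w" "inj_on (\<lambda>x. x mod p) (nonzeros (p ^ e) f)"
    and "nonzeros (p ^ e) f \<noteq> {}"
  shows "p ^ e < card (nonzeros (p ^ e) f) + card (nonzeros (p ^ e) (dft (p ^ e) w f))"
proof (rule ccontr)
  let ?n = "p ^ e"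
  assume *: "\<not> ?thesis"
  let ?B = "{..<?n} - nonzeros ?n (dft ?n w f)"
  have inj: "inj_on (\<lambda>k. w ^ k) ?B"
    using assms(2) by (auto simp: primroot_def intro: inj_on_subset)
  have "nonzeros ?n (dft ?n w f) \<subseteq> {..<?n}" by (auto simp: nonzeros_def)
  then have "card ?B = ?n - card (nonzeros ?n (dft ?n w f))"
    by (simp add: card_Diff_subset)
  with * inj have card: "card (nonzeros ?n f) \<le> card ((\<lambda>k. w ^ k) ` ?B)"
    by (simp add: card_image)
  have "\<forall>x\<in>nonzeros ?n f. f x = 0"
  proof (rule sparse_vanishing_imp_zero[OF assms(1) _ finite_nonzeros assms(3) _ _ card])
    fix z assume "z \<in> (\<lambda>k. w ^ k) ` ?B"
    then obtain k where k: "k < ?n" "dft ?n w f k = 0" "z = w ^ k" by (auto simp: nonzeros_def)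
    have "(\<Sum>a\<in>nonzeros ?n f. f a * z ^ a) = (\<Sum>a<?n. f a * z ^ a)"
      by (intro sum.mono_neutral_left) (auto simp: nonzeros_def)
    also have "\<dots> = dft ?n w f k" by (simp add: dft_def k mult.commute flip: power_mult)
    finally show "(\<Sum>a\<in>nonzeros ?n f. f a * z ^ a) = 0" using k by simp
  qed (use assms(2) in \<open>auto simp: primroot_def\<close>)
  then show False using assms(4) by (auto simp: nonzeros_def)
qed

text \<open>The case \<open>e = 1\<close>, where distinct points below \<open>p\<close> have
  distinct residues.\<close>

corollary uncertainty_prime:
  assumes "prime p" "primroot p w" "nonzeros p f \<noteq> {}"
  shows "p < card (nonzeros p f) + card (nonzeros p (dft p w f))"
  using uncertainty_distinct_residues[of p 1 w f] assms
  by (force simp: nonzeros_def inj_on_def)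

text \<open>The polynomial with the \<open>k - 1\<close> roots
  \<open>w ^ 0, ..., w ^ (k - 2)\<close> has at most \<open>k\<close> coefficients, and its
  transform vanishes at exactly \<open>k - 1\<close> frequencies. The uncertainty principle then
  makes all \<open>k\<close> coefficients nonzero.\<close>

lemma uncertainty_prime_sharp:
  assumes "prime p" "primroot p w" "k \<in> {1..p}"
  shows "\<exists>g. card (nonzeros p g) = k \<and> card (nonzeros p (dft p w g)) = p - k + 1"
proof -
  define P where "P = (\<Prod>i<k - 1. [:- (w ^ i), 1:])"
  have deg: "degree P = k - 1"
    unfolding P_def by (subst degree_prod_eq_sum_degree) auto
  have "poly P (w ^ j) = dft p w (coeff P) j" for j
  proof -
    have "poly P (w ^ j) = (\<Sum>i\<le>k - 1. coeff P i * (w ^ j) ^ i)"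
      by (simp add: poly_altdef deg)
    also have "\<dots> = (\<Sum>i<p. coeff P i * (w ^ j) ^ i)"
      using assms(3) deg by (intro sum.mono_neutral_left) (auto simp: coeff_eq_0)
    finally show ?thesis by (simp add: dft_def mult.commute flip: power_mult)
  qed
  moreover have "poly P (w ^ j) = 0 \<longleftrightarrow> j < k - 1" if "j < p" for j
  proof -
    have "poly P (w ^ j) = 0 \<longleftrightarrow> (\<exists>i<k - 1. w ^ j = w ^ i)"
      by (auto simp: P_def poly_prod)
    also have "\<dots> \<longleftrightarrow> j < k - 1"
      using that assms(3) by (auto simp: primroot_power_eq_iff[OF assms(2)])
    finally show ?thesis .
  qed
  ultimately have "nonzeros p (dft p w (coeff P)) = {k - 1..<p}"
    by (auto simp: nonzeros_def not_less)
  then have c: "card (nonzeros p (dft p w (coeff P))) = p - k + 1"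
    using assms(3) by auto
  have "nonzeros p (coeff P) \<subseteq> {..<k}"
    using deg assms(3) by (auto simp: nonzeros_def intro: le_degree le_less_trans)
  then have "card (nonzeros p (coeff P)) \<le> k"
    using card_mono[of "{..<k}"] by fastforce
  moreover have "nonzeros p (coeff P) \<noteq> {}"
    using c nonzeros_dft_empty_iff[OF assms(2), of "coeff P"] by auto
  ultimately show ?thesis
    using uncertainty_prime[OF assms(1,2), of "coeff P"] c assms(3)
    by (intro exI[of _ "coeff P"]) auto
qed

subsection \<open>Digit decomposition modulo \<open>p * p\<close>\<close>

lemma digits_less:
  fixes p :: nat
  assumes "a < p" "b < p"
  shows "p * a + b < p * p"
proof -
  have "p * a + b < p * Suc a" using assms by simp
  also have "\<dots> \<le> p * p" using assms by (intro mult_le_mono2) simp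
  finally show ?thesis .
qed

lemma sum_digits: "(\<Sum>x<p * p. h x) = (\<Sum>b<p. \<Sum>a<p. h (p * a + b))" for p :: nat
proof (cases "p = 0")
  case False
  have "(\<Sum>x<p * p. h x) = (\<Sum>(b, a)\<in>{..<p} \<times> {..<p}. h (p * a + b))"
    using False
    by (intro sum.reindex_bij_witness[of _ "\<lambda>(b, a). p * a + b" "\<lambda>x. (x mod p, x div p)"])
      (auto simp: digits_less less_mult_imp_div_less)
  then show ?thesis by (simp add: sum.cartesian_product)
qed simp

lemma card_nonzeros_digits:
  "card (nonzeros (p * p) f) = (\<Sum>b<p. card (nonzeros p (\<lambda>a. f (p * a + b))))"
proof -
  have c: "card (nonzeros n h) = (\<Sum>x<n. if h x \<noteq> 0 then 1 else 0)" for n and h :: "nat \<Rightarrow> complex"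
    by (simp add: nonzeros_def sum.If_cases Int_def flip: lessThan_iff)
  show ?thesis unfolding c by (rule sum_digits)
qed

lemma residues_nonzeros:
  assumes "p > 0"
  shows "(\<lambda>x. x mod p) ` nonzeros (p * p) f = {b. b < p \<and> nonzeros p (\<lambda>a. f (p * a + b)) \<noteq> {}}"
proof (intro equalityI subsetI)
  fix b assume "b \<in> (\<lambda>x. x mod p) ` nonzeros (p * p) f"
  then obtain x where "x < p * p" "f x \<noteq> 0" "b = x mod p" by (auto simp: nonzeros_def)
  then have "x div p \<in> nonzeros p (\<lambda>a. f (p * a + b))" "b < p"
    using assms by (auto simp: nonzeros_def less_mult_imp_div_less)
  then show "b \<in> {b. b < p \<and> nonzeros p (\<lambda>a. f (p * a + b)) \<noteq> {}}" by blast
next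
  fix b assume "b \<in> {b. b < p \<and> nonzeros p (\<lambda>a. f (p * a + b)) \<noteq> {}}"
  then obtain a where "b < p" "a < p" "f (p * a + b) \<noteq> 0" by (auto simp: nonzeros_def)
  then show "b \<in> (\<lambda>x. x mod p) ` nonzeros (p * p) f"
    by (intro image_eqI[of _ _ "p * a + b"]) (auto simp: nonzeros_def digits_less)
qed

text \<open>One Cooley-Tukey step. Since \<open>(p * a + b) * (p * l + k)\<close> is congruent to
  \<open>b * k + p * (a * k + b * l)\<close> modulo \<open>p * p\<close>, the transform splits into
  one on each coset followed by one across the cosets, with twiddle factors
  \<open>w ^ (b * k)\<close>.\<close>

lemma dft_digits:
  assumes "w ^ (p * p) = 1"
  shows "dft (p * p) w f (p * l + k) =
    dft p (w ^ p) (\<lambda>b. w ^ (b * k) * dft p (w ^ p) (\<lambda>a. f (p * a + b)) k) l"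
proof -
  have "w ^ ((p * a + b) * (p * l + k)) = w ^ (b * k) * (w ^ p) ^ (a * k) * (w ^ p) ^ (b * l)" for a b
  proof -
    have "(p * a + b) * (p * l + k) = b * k + p * (a * k) + p * (b * l) + (p * p) * (a * l)"
      by (simp add: algebra_simps)
    then have "w ^ ((p * a + b) * (p * l + k)) =
        w ^ (b * k) * w ^ (p * (a * k)) * w ^ (p * (b * l)) * (w ^ (p * p)) ^ (a * l)"
      by (simp only: power_add power_mult)
    then show ?thesis using assms by (simp flip: power_mult)
  qed
  then show ?thesis
    by (simp add: dft_def sum_digits sum_distrib_left sum_distrib_right mult_ac)
qed

section \<open>Residue counts, Meshulam's bound and rigidity\<close>

definition residue_set :: "nat \<Rightarrow> (nat \<Rightarrow> complex) \<Rightarrow> nat set" where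
  "residue_set p f = (\<lambda>x. x mod p) ` nonzeros (p * p) f"

lemma card_residue_set:
  assumes "p > 0" "nonzeros (p * p) f \<noteq> {}"
  shows "card (residue_set p f) \<in> {1..p}"
proof -
  have "residue_set p f \<subseteq> {..<p}" using assms(1) by (auto simp: residue_set_def)
  from card_mono[OF _ this] show ?thesis
    using assms by (auto simp: residue_set_def Suc_le_eq card_gt_0_iff)
qed

lemma residue_set_dft_inversion:
  "primroot (p * p) w \<Longrightarrow> residue_set p (dft (p * p) (inverse w) (dft (p * p) w f)) = residue_set p f"
  by (simp add: residue_set_def nonzeros_dft_inversion)

text \<open>If the transform of some row is nonzero at \<open>k\<close>, the outer transform in the
  digit formula has nonzero input, so \<open>?F\<close> is nonzero somewhere above \<open>k\<close>.
  Hence the transform of each row lives in \<open>?T\<close>, and a nonzero row has at least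
  \<open>p + 1 - card ?T\<close> points by the uncertainty principle.\<close>

lemma residue_count:
  assumes "prime p" "primroot (p * p) w" "nonzeros (p * p) f \<noteq> {}"
  shows "card (residue_set p f) * (p + 1 - card (residue_set p (dft (p * p) w f)))
    \<le> card (nonzeros (p * p) f)"
proof -
  let ?F = "dft (p * p) w f" and ?row = "\<lambda>b a. f (p * a + b)"
  let ?S = "residue_set p f" and ?T = "residue_set p (dft (p * p) w f)"
  have p: "p > 0" using assms(1) by (rule prime_gt_0_nat)
  have v: "primroot p (w ^ p)" using assms(2) by (rule primroot_power)
  have S: "?S = {b. b < p \<and> nonzeros p (?row b) \<noteq> {}}"
    and T: "?T = {b. b < p \<and> nonzeros p (\<lambda>a. ?F (p * a + b)) \<noteq> {}}"
    by (simp_all add: residue_set_def residues_nonzeros p)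
  have "finite ?T" by (simp add: residue_set_def)
  have row: "p + 1 - card ?T \<le> card (nonzeros p (?row b))" if "b \<in> ?S" for b
  proof -
    have "nonzeros p (dft p (w ^ p) (?row b)) \<subseteq> ?T"
    proof
      fix k assume k: "k \<in> nonzeros p (dft p (w ^ p) (?row b))"
      let ?h = "\<lambda>b. w ^ (b * k) * dft p (w ^ p) (?row b) k"
      have "b \<in> nonzeros p ?h"
        using that k primroot_nonzero[OF assms(2)] by (simp add: S nonzeros_def)
      then have "nonzeros p (dft p (w ^ p) ?h) \<noteq> {}"
        using nonzeros_dft_empty_iff[OF v] by blast
      moreover have "(\<lambda>l. ?F (p * l + k)) = dft p (w ^ p) ?h"
        using assms(2) by (simp add: dft_digits primroot_def)
      ultimately have "nonzeros p (\<lambda>l. ?F (p * l + k)) \<noteq> {}" by simp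
      then show "k \<in> ?T" using k by (simp add: T nonzeros_def[of p "dft p (w ^ p) (?row b)"])
    qed
    then have "card (nonzeros p (dft p (w ^ p) (?row b))) \<le> card ?T"
      using \<open>finite ?T\<close> by (rule card_mono[rotated])
    moreover have "p < card (nonzeros p (?row b)) + card (nonzeros p (dft p (w ^ p) (?row b)))"
      using that by (intro uncertainty_prime assms(1) v) (simp add: S)
    ultimately show ?thesis by linarith
  qed
  have "card ?S * (p + 1 - card ?T) = (\<Sum>b\<in>?S. p + 1 - card ?T)" by simp
  also have "\<dots> \<le> (\<Sum>b\<in>?S. card (nonzeros p (?row b)))"
    using row by (rule sum_mono)
  also have "\<dots> \<le> (\<Sum>b<p. card (nonzeros p (?row b)))"
    by (rule sum_mono2) (auto simp: S)
  finally show ?thesis by (simp add: card_nonzeros_digits)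
qed

lemma residue_counts:
  fixes p w f
  defines "K \<equiv> card (nonzeros (p * p) f)" and "L \<equiv> card (nonzeros (p * p) (dft (p * p) w f))"
    and "s \<equiv> card (residue_set p f)"
  assumes "prime p" "primroot (p * p) w" "nonzeros (p * p) f \<noteq> {}"
  obtains v where "s \<in> {1..p}" "v \<in> {1..p}" "s * v \<le> K" "(p + 1 - v) * (p + 1 - s) \<le> L"
proof
  let ?F = "dft (p * p) w f"
  let ?v = "p + 1 - card (residue_set p ?F)"
  have p: "p > 0" using assms(4) by (rule prime_gt_0_nat)
  have ne: "nonzeros (p * p) ?F \<noteq> {}"
    using assms nonzeros_dft_empty_iff by blast
  show "s \<in> {1..p}" using card_residue_set[OF p assms(6)] by (simp add: s_def)
  show v: "?v \<in> {1..p}" using card_residue_set[OF p ne] by auto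
  show "s * ?v \<le> K" using residue_count[OF assms(4-6)] by (simp add: K_def s_def)
  show "(p + 1 - ?v) * (p + 1 - s) \<le> L"
    using residue_count[OF assms(4) primroot_inverse[OF assms(5)] ne] card_residue_set[OF p ne]
    by (simp add: L_def s_def residue_set_dft_inversion[OF assms(5)])
qed

text \<open>Isolates the excess over \<open>p * p + p\<close> as a multiple of
  \<open>(s - 1) * (v - 1)\<close>: its sign gives the bound and its vanishing gives rigidity. The
  integers are used because the factors involve subtraction.\<close>

lemma meshulam_identity:
  fixes p s v :: nat
  assumes "s \<in> {1..p}" "v \<in> {1..p}"
  shows "int ((p + 1 - v) * (p + 1 - s) + p * (s * v)) =
    int (p * p + p) + (int p + 1) * ((int s - 1) * (int v - 1))"
proof -
  have "int (p + 1 - v) = int p + 1 - int v" "int (p + 1 - s) = int p + 1 - int s"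
    using assms by auto
  then show ?thesis by (simp only: of_nat_add of_nat_mult) (simp add: algebra_simps)
qed

lemma meshulam_bound:
  assumes "prime p" "primroot (p * p) w" "nonzeros (p * p) f \<noteq> {}"
  shows "p * p + p \<le> card (nonzeros (p * p) (dft (p * p) w f)) + p * card (nonzeros (p * p) f)"
    (is "_ \<le> ?L + p * ?K")
proof -
  obtain v where v: "card (residue_set p f) \<in> {1..p}" "v \<in> {1..p}"
    "card (residue_set p f) * v \<le> ?K" "(p + 1 - v) * (p + 1 - card (residue_set p f)) \<le> ?L"
    using residue_counts[OF assms] by metis
  let ?s = "card (residue_set p f)"
  have "p * (?s * v) \<le> p * ?K" using v(3) by (rule mult_le_mono2)
  with v(4) have "(p + 1 - v) * (p + 1 - ?s) + p * (?s * v) \<le> ?L + p * ?K" by linarith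
  then have "int ((p + 1 - v) * (p + 1 - ?s) + p * (?s * v)) \<le> int (?L + p * ?K)"
    by (simp only: of_nat_le_iff)
  moreover have "0 \<le> (int p + 1) * ((int ?s - 1) * (int v - 1))" using v by simp
  ultimately have "int (p * p + p) \<le> int (?L + p * ?K)"
    unfolding meshulam_identity[OF v(1,2)] by linarith
  then show ?thesis by (simp only: of_nat_le_iff)
qed

text \<open>An excess below \<open>p\<close> leaves no room for a positive multiple of
  \<open>p + 1\<close>, so \<open>s = 1\<close> or \<open>v = 1\<close>. The exceptional value does
  occur: the difference of the point masses at 0 and 1 has a transform vanishing only at 0. Its dual
  explains why support size \<open>p * p - 1\<close> is set apart.\<close>

lemma meshulam_rigidity:
  assumes "prime p" "primroot (p * p) w" "nonzeros (p * p) f \<noteq> {}"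
    and less: "card (nonzeros (p * p) (dft (p * p) w f)) + p * card (nonzeros (p * p) f) < p * p + 2 * p"
      (is "?L + p * ?K < _")
  shows "card (residue_set p f) = 1 \<or> ?L + 1 = p * p"
proof -
  let ?s = "card (residue_set p f)"
  obtain v where v: "?s \<in> {1..p}" "v \<in> {1..p}"
    "?s * v \<le> ?K" "(p + 1 - v) * (p + 1 - ?s) \<le> ?L"
    using residue_counts[OF assms(1-3)] by metis
  have p: "p \<ge> 2" using assms(1) by (rule prime_ge_2_nat)
  have "p * (?s * v) \<le> p * ?K" using v(3) by (rule mult_le_mono2)
  with v(4) less have "(p + 1 - v) * (p + 1 - ?s) + p * (?s * v) < p * p + 2 * p" by linarith
  then have "int ((p + 1 - v) * (p + 1 - ?s) + p * (?s * v)) < int (p * p + 2 * p)"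
    by (simp only: of_nat_less_iff)
  then have "(int p + 1) * ((int ?s - 1) * (int v - 1)) < (int p + 1) * 1"
    unfolding meshulam_identity[OF v(1,2)] by simp
  then have "(int ?s - 1) * (int v - 1) < 1"
    by (rule mult_left_less_imp_less) simp
  moreover have "0 \<le> (int ?s - 1) * (int v - 1)" using v by simp
  ultimately have "(int ?s - 1) * (int v - 1) = 0" by linarith
  then have "?s = 1 \<or> v = 1" by simp
  moreover have "?L + 1 = p * p" if "v = 1" "?s \<noteq> 1"
  proof -
    have s: "?s \<ge> 2" using v that by auto
    \<comment> \<open>A further point of the support would add \<open>p\<close> to the left-hand
      side and exhaust the slack. So \<open>f\<close> has exactly one point above each residue it
      meets.\<close>
    have "?K = ?s"
    proof (rule ccontr)
      assume "?K \<noteq> ?s"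
      with v that have "p * (?s + 1) \<le> p * ?K" by (intro mult_le_mono2) auto
      moreover have "p * (p + 1 - ?s) \<le> ?L" using v that by simp
      moreover have "p * (p + 1 - ?s) + p * (?s + 1) = p * p + 2 * p"
      proof -
        have "p * (p + 1 - ?s) + p * (?s + 1) = p * ((p + 1 - ?s) + (?s + 1))"
          by (simp add: distrib_left)
        also have "(p + 1 - ?s) + (?s + 1) = p + 2" using v by simp
        finally show ?thesis by (simp add: algebra_simps)
      qed
      ultimately show False using less by linarith
    qed
    then have "inj_on (\<lambda>x. x mod p) (nonzeros (p * p) f)"
      by (intro eq_card_imp_inj_on) (simp_all add: residue_set_def)
    then have big: "p * p < ?K + ?L"
      using uncertainty_distinct_residues[of p 2 w f] assms by (simp add: power2_eq_square)
    \<comment> \<open>With \<open>q = p - 1\<close>, the two bounds combine to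
      \<open>q * ?K \<le> 2 * q\<close>. Then \<open>?K = 2\<close>, and \<open>?L\<close> lies
      strictly between \<open>p * p - 2\<close> and \<open>p * p\<close>.\<close>
    obtain q where q: "p = Suc q" "q \<ge> 1" using p by (cases p) auto
    have "p * ?K + 2 \<le> ?K + 2 * p" using big less by linarith
    then have "q * ?K \<le> q * 2" unfolding q(1) by simp
    then have "?K = 2" using s \<open>?K = ?s\<close> q(2) by simp
    then show ?thesis using big less by simp
  qed
  ultimately show ?thesis by blast
qed

section \<open>Functions on one coset and the equality cases with small support\<close>

text \<open>Only one row survives in the digit formula, so the transform repeats the transform of
  that row \<open>p\<close> times, up to nonzero phases.\<close>

lemma nonzeros_single_residue:
  assumes "p > 0" "primroot (p * p) w" "a < p"
    and off: "\<And>x b. x < p \<Longrightarrow> b < p \<Longrightarrow> b \<noteq> a \<Longrightarrow> f (p * x + b) = 0"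
  shows "card (nonzeros (p * p) f) = card (nonzeros p (\<lambda>x. f (p * x + a)))"
    and "card (nonzeros (p * p) (dft (p * p) w f)) =
      p * card (nonzeros p (dft p (w ^ p) (\<lambda>x. f (p * x + a))))"
    and "dft (p * p) w f (p * l + k) = w ^ (a * (p * l + k)) * dft p (w ^ p) (\<lambda>x. f (p * x + a)) k"
proof -
  let ?g = "\<lambda>x. f (p * x + a)"
  have "(\<Sum>b<p. card (nonzeros p (\<lambda>x. f (p * x + b)))) =
      (\<Sum>b<p. if b = a then card (nonzeros p ?g) else 0)"
    using off by (intro sum.cong) (auto simp: nonzeros_def)
  then show "card (nonzeros (p * p) f) = card (nonzeros p ?g)"
    using assms(3) by (simp add: card_nonzeros_digits)
  show F: "dft (p * p) w f (p * l + k) = w ^ (a * (p * l + k)) * dft p (w ^ p) ?g k" for l k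
  proof -
    have "dft (p * p) w f (p * l + k) =
        dft p (w ^ p) (\<lambda>b. w ^ (b * k) * dft p (w ^ p) (\<lambda>x. f (p * x + b)) k) l"
      using assms(2) by (simp add: dft_digits primroot_def)
    also have "\<dots> = (\<Sum>b<p. if b = a then w ^ (a * k) * dft p (w ^ p) ?g k * (w ^ p) ^ (a * l) else 0)"
      unfolding dft_def[of p _ _ l]
    proof (intro sum.cong refl)
      fix b assume "b \<in> {..<p}"
      moreover have "dft p (w ^ p) (\<lambda>x. f (p * x + b)) k = 0" if "b \<noteq> a" "b < p"
        using off that by (simp add: dft_def)
      ultimately show "w ^ (b * k) * dft p (w ^ p) (\<lambda>x. f (p * x + b)) k * (w ^ p) ^ (b * l) =
          (if b = a then w ^ (a * k) * dft p (w ^ p) ?g k * (w ^ p) ^ (a * l) else 0)" by auto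
    qed
    also have "\<dots> = w ^ (a * k) * (w ^ p) ^ (a * l) * dft p (w ^ p) ?g k"
      using assms(3) by (simp add: mult_ac)
    also have "w ^ (a * k) * (w ^ p) ^ (a * l) = w ^ (a * (p * l + k))"
      by (simp add: distrib_left mult.commute mult.left_commute add.commute flip: power_mult power_add)
    finally show ?thesis .
  qed
  have "card (nonzeros p (\<lambda>l. dft (p * p) w f (p * l + k))) =
      p * (if dft p (w ^ p) ?g k \<noteq> 0 then 1 else 0)" for k
    unfolding F using primroot_nonzero[OF assms(2)] by (simp add: nonzeros_def lessThan_def[symmetric])
  then show "card (nonzeros (p * p) (dft (p * p) w f)) = p * card (nonzeros p (dft p (w ^ p) ?g))"
    unfolding card_nonzeros_digits sum_distrib_left[symmetric]
    by (simp add: nonzeros_def sum_distrib_left[symmetric] sum.If_cases Int_def)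
qed

lemma card_residue_set_eq_1:
  assumes "p > 0" "card (residue_set p f) = 1"
  obtains a where "a < p" "\<And>x b. x < p \<Longrightarrow> b < p \<Longrightarrow> b \<noteq> a \<Longrightarrow> f (p * x + b) = 0"
proof -
  obtain a where a: "residue_set p f = {a}" using assms(2) by (auto simp: card_1_singleton_iff)
  show ?thesis
  proof
    have "a \<in> residue_set p f" using a by simp
    then show "a < p" using assms(1) by (auto simp: residue_set_def)
    fix x b assume xb: "x < p" "b < p" "b \<noteq> a"
    show "f (p * x + b) = 0"
    proof (rule ccontr)
      assume "f (p * x + b) \<noteq> 0"
      then have "p * x + b \<in> nonzeros (p * p) f" using xb by (simp add: nonzeros_def digits_less)
      then have "(p * x + b) mod p \<in> residue_set p f" unfolding residue_set_def by blast
      then show False using a xb by simp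
    qed
  qed
qed

text \<open>The bound for the transform with the inverse root: transforming back restores the
  support of \<open>f\<close>.\<close>

lemma meshulam_bound_dual:
  assumes "prime p" "primroot (p * p) w" "nonzeros (p * p) f \<noteq> {}"
  shows "p * p + p \<le> card (nonzeros (p * p) f) + p * card (nonzeros (p * p) (dft (p * p) w f))"
proof -
  have "nonzeros (p * p) (dft (p * p) w f) \<noteq> {}"
    using nonzeros_dft_empty_iff[OF assms(2)] assms(3) by blast
  from meshulam_bound[OF assms(1) primroot_inverse[OF assms(2)] this] show ?thesis
    by (simp only: nonzeros_dft_inversion[OF assms(2)])
qed

text \<open>Equality leaves no excess, so rigidity applies; its exceptional value is ruled out
  because \<open>p * (p - K + 1)\<close> is a multiple of \<open>p\<close> and
  \<open>p * p - 1\<close> is not. Hence \<open>f\<close> lives on one coset and the problem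
  descends to the group of order \<open>p\<close>.\<close>

lemma equality_small_iff:
  assumes "prime p" "primroot (p * p) w" "K \<in> {1..p}"
  shows "card (nonzeros (p * p) f) = K \<and> card (nonzeros (p * p) (dft (p * p) w f)) = p * (p - K + 1) \<longleftrightarrow>
    (\<exists>g a. a < p \<and> card (nonzeros p g) = K \<and> card (nonzeros p (dft p (w ^ p) g)) = p - K + 1 \<and>
      (\<forall>x<p. \<forall>b<p. f (p * x + b) = g x * (if b = a then 1 else 0)))"
    (is "?lhs \<longleftrightarrow> ?rhs")
proof
  have p: "p > 0" using assms(1) by (rule prime_gt_0_nat)
  {
    assume ?lhs
    have "p * (p - K + 1) + p * K = p * p + p"
      using assms(3) by (simp flip: distrib_left)
    then have "card (nonzeros (p * p) (dft (p * p) w f)) + p * card (nonzeros (p * p) f) < p * p + 2 * p"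
      using \<open>?lhs\<close> p by simp
    moreover have "nonzeros (p * p) f \<noteq> {}" using \<open>?lhs\<close> assms(3) by auto
    moreover have "p * (p - K + 1) + 1 \<noteq> p * p"
      using assms(1) by (metis dvd_add_right_iff dvd_triv_left not_prime_unit)
    ultimately have "card (residue_set p f) = 1"
      using meshulam_rigidity[OF assms(1,2)] \<open>?lhs\<close> by metis
    then obtain a where a: "a < p" "\<And>x b. x < p \<Longrightarrow> b < p \<Longrightarrow> b \<noteq> a \<Longrightarrow> f (p * x + b) = 0"
      using card_residue_set_eq_1[OF p] by metis
    note single = nonzeros_single_residue[OF p assms(2), where f = f, OF a]
    have "p * card (nonzeros p (dft p (w ^ p) (\<lambda>x. f (p * x + a)))) = p * (p - K + 1)"
      using \<open>?lhs\<close> single(2) by simp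
    then have "card (nonzeros p (dft p (w ^ p) (\<lambda>x. f (p * x + a)))) = p - K + 1"
      using p by (simp only: mult_cancel1) simp
    then show ?rhs
      using \<open>?lhs\<close> single(1) a
      by (intro exI[of _ "\<lambda>x. f (p * x + a)"] exI[of _ a]) auto
  }
  {
    assume ?rhs
    then obtain g a where g: "a < p" "card (nonzeros p g) = K"
      "card (nonzeros p (dft p (w ^ p) g)) = p - K + 1"
      "\<And>x b. x < p \<Longrightarrow> b < p \<Longrightarrow> f (p * x + b) = g x * (if b = a then 1 else 0)" by blast
    have off: "f (p * x + b) = 0" if "x < p" "b < p" "b \<noteq> a" for x b
      using g(4) that by simp
    note single = nonzeros_single_residue[OF p assms(2), where f = f, OF g(1) off]
    have "nonzeros p (\<lambda>x. f (p * x + a)) = nonzeros p g"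
      using g by (intro nonzeros_cong) simp
    moreover have "dft p (w ^ p) (\<lambda>x. f (p * x + a)) = dft p (w ^ p) g"
      using g by (intro ext dft_cong) simp
    ultimately show ?lhs using single(1,2) g by simp
  }
qed

section \<open>Modulated periodic functions and the equality cases with large support\<close>

lemma card_nonzeros_shift:
  assumes "n > 0" "\<And>k. h (k mod n) = h k"
  shows "card (nonzeros n (\<lambda>k. h (c + k))) = card (nonzeros n h)"
proof -
  have "bij_betw (\<lambda>k. (c + k) mod n) (nonzeros n (\<lambda>k. h (c + k))) (nonzeros n h)"
  \<comment> \<open>Adding \<open>n - c mod n\<close> is subtraction of \<open>c\<close> modulo
    \<open>n\<close> without leaving the natural numbers.\<close>
  proof (rule bij_betw_byWitness[where f' = "\<lambda>k. (k + (n - c mod n)) mod n"])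
    have *: "((c + k) mod n + (n - c mod n)) mod n = k" "(c + (k + (n - c mod n)) mod n) mod n = k"
      if "k < n" for k
    proof -
      have "((c + k) mod n + (n - c mod n)) mod n = (c mod n + (k + (n - c mod n))) mod n"
        by (simp only: mod_add_left_eq add.assoc)
      also have "c mod n + (k + (n - c mod n)) = k + n"
        using mod_less_divisor[OF assms(1), of c] by linarith
      finally show "((c + k) mod n + (n - c mod n)) mod n = k" using that by simp
      have "(c + (k + (n - c mod n)) mod n) mod n = (c mod n + (k + (n - c mod n))) mod n"
        by (simp only: mod_add_left_eq mod_add_right_eq)
      also have "c mod n + (k + (n - c mod n)) = k + n"
        using mod_less_divisor[OF assms(1), of c] by linarith
      finally show "(c + (k + (n - c mod n)) mod n) mod n = k" using that by simp
    qed
    show "\<forall>k\<in>nonzeros n (\<lambda>k. h (c + k)). ((c + k) mod n + (n - c mod n)) mod n = k"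
      using * by (auto simp: nonzeros_def)
    show "\<forall>k\<in>nonzeros n h. (c + (k + (n - c mod n)) mod n) mod n = k"
      using * by (auto simp: nonzeros_def)
    show "(\<lambda>k. (c + k) mod n) ` nonzeros n (\<lambda>k. h (c + k)) \<subseteq> nonzeros n h"
      using assms by (auto simp: nonzeros_def)
    show "(\<lambda>k. (k + (n - c mod n)) mod n) ` nonzeros n h \<subseteq> nonzeros n (\<lambda>k. h (c + k))"
    proof clarify
      fix k assume k: "k \<in> nonzeros n h"
      have "h (c + (k + (n - c mod n)) mod n) = h ((c + (k + (n - c mod n)) mod n) mod n)"
        by (simp only: assms(2))
      also have "\<dots> = h k" using *(2)[of k] k by (simp add: nonzeros_def)
      finally show "(k + (n - c mod n)) mod n \<in> nonzeros n (\<lambda>k. h (c + k))"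
        using k assms(1) by (simp add: nonzeros_def)
    qed
  qed
  then show ?thesis by (rule bij_betw_same_card)
qed

text \<open>Modulation by the powers \<open>w ^ (c * x)\<close> only translates the spectrum. What
  remains is a \<open>p\<close>-periodic function, whose transform lives on the multiples of
  \<open>p\<close> and is there \<open>p\<close> times the transform of \<open>g\<close>.\<close>

lemma nonzeros_dft_modulated_periodic:
  assumes "p > 0" "primroot (p * p) w"
    and f: "\<And>x b. x < p \<Longrightarrow> b < p \<Longrightarrow> f (p * x + b) = w ^ (c * (p * x + b)) * g b"
  shows "card (nonzeros (p * p) f) = p * card (nonzeros p g)"
    and "card (nonzeros (p * p) (dft (p * p) w f)) = card (nonzeros p (dft p (w ^ p) g))"
proof -
  note w0 = primroot_nonzero[OF assms(2)]
  have v: "primroot p (w ^ p)" using assms(2) by (rule primroot_power)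
  have wpp: "w ^ (p * p) = 1" using assms(2) by (simp add: primroot_def)
  have "card (nonzeros p (\<lambda>x. f (p * x + b))) = p * (if g b \<noteq> 0 then 1 else 0)" if "b < p" for b
  proof -
    have "nonzeros p (\<lambda>x. f (p * x + b)) = (if g b \<noteq> 0 then {..<p} else {})"
      using that w0 by (auto simp: nonzeros_def f)
    then show ?thesis by simp
  qed
  then have "card (nonzeros (p * p) f) = (\<Sum>b<p. p * (if g b \<noteq> 0 then 1 else 0))"
    unfolding card_nonzeros_digits by (intro sum.cong) auto
  also have "\<dots> = p * card (nonzeros p g)"
    by (simp add: nonzeros_def sum.If_cases Int_def flip: sum_distrib_left)
  finally show "card (nonzeros (p * p) f) = p * card (nonzeros p g)" .

  define h where "h x = g (x mod p)" for x
  have "dft (p * p) w f = (\<lambda>k. dft (p * p) w h (c + k))"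
    unfolding dft_def
  proof (intro ext sum.cong refl)
    fix k x assume "x \<in> {..<p * p}"
    then have "f x = w ^ (c * x) * h x"
      using f[of "x div p" "x mod p"] assms(1) by (simp add: h_def less_mult_imp_div_less)
    then show "f x * w ^ (x * k) = h x * w ^ (x * (c + k))"
      by (simp add: distrib_left power_add mult_ac)
  qed
  then have "card (nonzeros (p * p) (dft (p * p) w f)) = card (nonzeros (p * p) (dft (p * p) w h))"
    using card_nonzeros_shift[of "p * p" "dft (p * p) w h" c] assms(1) dft_mod[OF assms(2)]
    by simp
  also have "\<dots> = card (nonzeros p (dft p (w ^ p) g))"
  proof -
    have H: "dft (p * p) w h (p * l + k) = (if k = 0 then of_nat p * dft p (w ^ p) g l else 0)"
      if "k < p" for l k
    proof -
      \<comment> \<open>Each row of \<open>h\<close> is constant, so its transform is a full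
        geometric sum, zero unless \<open>k = 0\<close>.\<close>
      have const: "dft p (w ^ p) (\<lambda>a. h (p * a + b)) k = (if k = 0 then of_nat p * g b else 0)"
        if "b < p" for b
      proof -
        have "dft p (w ^ p) (\<lambda>a. h (p * a + b)) k = g b * (\<Sum>a<p. ((w ^ p) ^ k) ^ a)"
          using that by (simp add: dft_def h_def sum_distrib_left mult_ac flip: power_mult)
        moreover have "(w ^ p) ^ k \<noteq> 1" if "k \<noteq> 0"
          using primroot_power_eq_iff[OF v, of k 0] \<open>k < p\<close> that by simp
        moreover have "((w ^ p) ^ k) ^ p = (w ^ (p * p)) ^ k"
          by (simp add: mult_ac flip: power_mult)
        then have "((w ^ p) ^ k) ^ p = 1" using wpp by simp
        ultimately show ?thesis by (simp add: geometric_sum)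
      qed
      have "dft (p * p) w h (p * l + k) =
          dft p (w ^ p) (\<lambda>b. w ^ (b * k) * dft p (w ^ p) (\<lambda>a. h (p * a + b)) k) l"
        by (rule dft_digits[OF wpp])
      also have "\<dots> = dft p (w ^ p) (\<lambda>b. (if k = 0 then of_nat p else 0) * g b) l"
        by (intro dft_cong) (simp add: const)
      finally show ?thesis by (simp add: dft_mult)
    qed
    have "card (nonzeros (p * p) (dft (p * p) w h)) =
        (\<Sum>k<p. if k = 0 then card (nonzeros p (dft p (w ^ p) g)) else 0)"
      unfolding card_nonzeros_digits using assms(1)
      by (intro sum.cong) (auto simp: H nonzeros_def)
    then show ?thesis using assms(1) by simp
  qed
  finally show "card (nonzeros (p * p) (dft (p * p) w f)) = card (nonzeros p (dft p (w ^ p) g))" .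
qed

text \<open>Rigidity for the transform: here the excess over \<open>p * p + p\<close> is the
  remainder of the support size modulo \<open>p\<close>, hence below \<open>p\<close>. The
  exceptional case is the excluded size \<open>p * p - 1\<close>.\<close>

lemma equality_large_single_residue:
  assumes "prime p" "primroot (p * p) w"
    and K: "p \<le> card (nonzeros (p * p) f)" "card (nonzeros (p * p) f) + 1 \<noteq> p * p"
    and L: "card (nonzeros (p * p) (dft (p * p) w f)) = p - card (nonzeros (p * p) f) div p + 1"
  obtains c where "c < p"
    "\<And>x b. x < p \<Longrightarrow> b < p \<Longrightarrow> b \<noteq> c \<Longrightarrow> dft (p * p) w f (p * x + b) = 0"
proof -
  let ?F = "dft (p * p) w f" and ?K = "card (nonzeros (p * p) f)"
  have p: "p > 0" using assms(1) by (rule prime_gt_0_nat)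
  have "?K \<le> p * p" by (rule card_nonzeros_le)
  then have "?K div p \<le> p" using div_le_mono[of ?K "p * p" p] p by simp
  then have "p * (p - ?K div p + 1) + p * (?K div p) = p * p + p"
    by (simp flip: distrib_left)
  moreover have "?K < p * (?K div p) + p"
    using p by (metis add.commute add_less_cancel_left mod_less_divisor mult_div_mod_eq)
  ultimately have less: "?K + p * card (nonzeros (p * p) ?F) < p * p + 2 * p"
    unfolding L by linarith
  have "nonzeros (p * p) f \<noteq> {}" using K p by auto
  then have "card (residue_set p ?F) = 1"
    using meshulam_rigidity[OF assms(1) primroot_inverse[OF assms(2)], of ?F] less K(2)
    by (simp add: nonzeros_dft_inversion[OF assms(2)] nonzeros_dft_empty_iff[OF assms(2)])
  then show ?thesis using card_residue_set_eq_1[OF p] that by metis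
qed

text \<open>The transform lives on one coset, so transforming back gives a support whose size is a
  multiple of \<open>p\<close>.\<close>

lemma equality_large_imp_dvd:
  assumes "prime p" "primroot (p * p) w"
    and "p \<le> card (nonzeros (p * p) f)" "card (nonzeros (p * p) f) + 1 \<noteq> p * p"
    and "card (nonzeros (p * p) (dft (p * p) w f)) = p - card (nonzeros (p * p) f) div p + 1"
  shows "p dvd card (nonzeros (p * p) f)"
proof -
  have p: "p > 0" using assms(1) by (rule prime_gt_0_nat)
  obtain c where c: "c < p"
    "\<And>x b. x < p \<Longrightarrow> b < p \<Longrightarrow> b \<noteq> c \<Longrightarrow> dft (p * p) w f (p * x + b) = 0"
    using equality_large_single_residue[OF assms] by metis
  from nonzeros_single_residue(2)[OF p primroot_inverse[OF assms(2)],
      where f = "dft (p * p) w f", OF c] show ?thesis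
    by (simp add: nonzeros_dft_inversion[OF assms(2)])
qed

text \<open>Fourier inversion of a function living on the single residue \<open>k\<close> yields a
  phase of frequency \<open>- k\<close> times a \<open>p\<close>-periodic function.\<close>

lemma equality_large_iff:
  assumes "prime p" "primroot (p * p) w" "p \<le> p * j" "p * j + 1 \<noteq> p * p"
  shows "card (nonzeros (p * p) f) = p * j \<and> card (nonzeros (p * p) (dft (p * p) w f)) = p - j + 1 \<longleftrightarrow>
    (\<exists>g c. card (nonzeros p g) = j \<and> card (nonzeros p (dft p (w ^ p) g)) = p - j + 1 \<and>
      (\<forall>x<p. \<forall>b<p. f (p * x + b) = w ^ (c * (p * x + b)) * g b))"
    (is "?lhs \<longleftrightarrow> ?rhs")
proof
  have p: "p > 0" using assms(1) by (rule prime_gt_0_nat)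
  {
    assume ?rhs
    then show ?lhs using nonzeros_dft_modulated_periodic[OF p assms(2), of f] by metis
  }
  {
    assume ?lhs
    let ?F = "dft (p * p) w f" and ?u = "inverse w"
    note u = primroot_inverse[OF assms(2)]
    obtain k where k: "k < p"
      "\<And>x b. x < p \<Longrightarrow> b < p \<Longrightarrow> b \<noteq> k \<Longrightarrow> ?F (p * x + b) = 0"
      using equality_large_single_residue[OF assms(1,2), of f] \<open>?lhs\<close> assms(3,4) p by auto
    let ?G = "\<lambda>x. ?F (p * x + k)"
    \<comment> \<open>A natural number representing the frequency \<open>- k\<close>.\<close>
    define c where "c = p * p - k"
    \<comment> \<open>The denominator compensates for the factor in unnormalised Fourier
      inversion.\<close>
    define g where "g b = dft p (?u ^ p) ?G b / of_nat (p * p)" for b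
    have "p \<le> p * p" using p by simp
    then have "k \<le> p * p" using k(1) by linarith
    have wc: "w ^ (c * x) = ?u ^ (k * x)" for x
    proof -
      have "w ^ (c * x) * w ^ (k * x) = (w ^ (p * p)) ^ x"
        using \<open>k \<le> p * p\<close> by (simp add: c_def flip: power_add distrib_right power_mult)
      also have "\<dots> = 1" using assms(2) by (simp add: primroot_def)
      finally show ?thesis
        using primroot_nonzero[OF assms(2)] by (simp add: field_simps power_inverse)
    qed
    have f: "f (p * x + b) = w ^ (c * (p * x + b)) * g b" if "x < p" "b < p" for x b
    proof -
      have "of_nat (p * p) * f (p * x + b) = dft (p * p) ?u ?F (p * x + b)"
        using that by (subst dft_inversion[OF assms(2)]) (simp_all add: digits_less)
      also have "\<dots> = ?u ^ (k * (p * x + b)) * dft p (?u ^ p) ?G b"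
        by (rule nonzeros_single_residue(3)[OF p u, where f = ?F, OF k])
      also have "\<dots> = w ^ (c * (p * x + b)) * (of_nat (p * p) * g b)"
        unfolding wc using p by (simp add: g_def)
      finally show ?thesis using p by simp
    qed
    note modulated = nonzeros_dft_modulated_periodic[OF p assms(2) f]
    have "p * card (nonzeros p g) = p * j" using modulated(1) \<open>?lhs\<close> by metis
    then have "card (nonzeros p g) = j" using p by simp
    then show ?rhs
      using modulated(2) \<open>?lhs\<close> f by (intro exI[of _ g] exI[of _ c]) auto
  }
qed

subsection \<open>Characters of cyclic groups\<close>

lemma carrier_mod: "n > 0 \<Longrightarrow> carrier (integer_mod_group n) = {0..<int n}"
  by (simp add: carrier_integer_mod_group)

text \<open>A character is determined by its value at the generator, an \<open>n\<close>-th root of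
  unity and hence a power of \<open>w\<close>. The restriction matches the extensionality built into
  \<open>characters\<close>.\<close>

lemma characters_integer_mod_group:
  assumes "primroot n w"
  shows "bij_betw (\<lambda>c. restrict (\<lambda>x. w ^ (nat x * c)) {0..<int n}) {..<n}
    (characters (integer_mod_group n))"
proof -
  let ?G = "integer_mod_group n"
  let ?\<psi> = "\<lambda>c. restrict (\<lambda>x. w ^ (nat x * c)) {0..<int n}"
  have n: "n > 0" and wn: "w ^ n = 1" using assms by (auto simp: primroot_def)
  note C = carrier_mod[OF n]
  have "inj_on ?\<psi> {..<n}"
  proof (rule inj_onI)
    fix c d assume cd: "c \<in> {..<n}" "d \<in> {..<n}" "?\<psi> c = ?\<psi> d"
    show "c = d"
    proof (cases "n = 1")
      case False
      then have "?\<psi> c 1 = ?\<psi> d 1" using cd(3) by simp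
      then have "w ^ c = w ^ d" using False n by simp
      then show ?thesis using cd primroot_power_eq_iff[OF assms] by simp
    qed (use cd in simp)
  qed
  moreover have "?\<psi> c \<in> characters ?G" for c
  proof -
    have "norm w = 1" using wn n by (metis norm_one norm_power norm_ge_zero power_eq_1_iff less_numeral_extra(3))
    moreover have "w ^ (nat ((x + y) mod int n) * c) = w ^ (nat x * c) * w ^ (nat y * c)"
      if "x \<ge> 0" "y \<ge> 0" for x y
    proof -
      have "nat ((x + y) mod int n) = (nat x + nat y) mod n"
        using that by (simp add: nat_mod_distrib nat_add_distrib)
      then show ?thesis
        using primroot_power_eq_iff[OF assms, of "(nat x + nat y) mod n * c" "(nat x + nat y) * c"]
        by (simp add: mod_mult_left_eq distrib_right power_add)
    qed
    ultimately show ?thesis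
      using n by (auto simp: characters_def hom_def circle_group_def C norm_power)
  qed
  moreover have "\<psi> \<in> ?\<psi> ` {..<n}" if "\<psi> \<in> characters ?G" for \<psi>
  proof -
    have ext: "\<psi> \<in> extensional {0..<int n}"
      and hom: "\<And>x y. x \<in> {0..<int n} \<Longrightarrow> y \<in> {0..<int n} \<Longrightarrow> \<psi> ((x + y) mod int n) = \<psi> x * \<psi> y"
      and nz: "\<And>x. x \<in> {0..<int n} \<Longrightarrow> \<psi> x \<noteq> 0"
      using that by (auto simp: characters_def hom_def circle_group_def C Pi_def)
    have one: "\<psi> 0 = 1" using hom[of 0 0] nz[of 0] n by simp
    \<comment> \<open>The reduction covers \<open>n = 1\<close>, where 1 is outside the
      carrier.\<close>
    define z where "z = \<psi> (1 mod int n)"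
    have pow: "\<psi> (int k mod int n) = z ^ k" for k
    proof (induction k)
      case (Suc k)
      have "\<psi> ((int k mod int n + 1 mod int n) mod int n) = \<psi> (int k mod int n) * z"
        unfolding z_def using n by (intro hom) auto
      then show ?case using Suc by (simp add: mod_simps add.commute)
    qed (simp add: one)
    have "z ^ n = 1" using pow[of n] one by simp
    \<comment> \<open>The \<open>n\<close> distinct powers of \<open>w\<close> exhaust the
      \<open>n\<close> roots of unity by counting.\<close>
    have "(\<lambda>k. w ^ k) ` {..<n} = {z. z ^ n = 1}"
    proof (rule card_subset_eq)
      show "(\<lambda>k. w ^ k) ` {..<n} \<subseteq> {z. z ^ n = 1}"
        using wn by (auto simp: power_mult[symmetric]) (metis mult.commute power_mult power_one)
      show "card ((\<lambda>k. w ^ k) ` {..<n}) = card {z :: complex. z ^ n = 1}"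
        using assms n by (simp add: card_image primroot_def Complex.card_roots_unity_eq)
    qed (use n in \<open>auto intro: finite_roots_unity\<close>)
    with \<open>z ^ n = 1\<close> obtain c where c: "c < n" "z = w ^ c" by blast
    have "\<psi> = ?\<psi> c"
    proof (rule extensionalityI[OF ext])
      fix x assume x: "x \<in> {0..<int n}"
      then show "\<psi> x = ?\<psi> c x"
        using pow[of "nat x"] by (simp add: c(2) mult.commute flip: power_mult)
    qed simp
    then show ?thesis using c by blast
  qed
  ultimately show ?thesis by (auto simp: bij_betw_def)
qed

lemma fourier_integer_mod_group:
  assumes "primroot n w"
  shows "fourier (integer_mod_group n) f (restrict (\<lambda>x. w ^ (nat x * c)) {0..<int n}) =
    dft n (inverse w) (\<lambda>x. f (int x)) c"
proof -
  have n: "n > 0" using assms by (simp add: primroot_def)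
  have "w ^ (nat ((- x) mod int n) * c) = inverse w ^ (nat x * c)" if "x \<in> {0..<int n}" for x
  proof -
    have "nat ((- x) mod int n) + nat x = nat ((- x) mod int n + x)"
      using that by (simp add: nat_add_distrib)
    moreover have "((- x) mod int n + x) mod int n = 0" by (simp add: mod_simps)
    then have "int n dvd (- x) mod int n + x" by auto
    ultimately have "n dvd nat ((- x) mod int n) + nat x"
      using that n by (metis int_dvd_int_iff nat_0_le atLeastLessThan_iff add_nonneg_nonneg pos_mod_sign of_nat_0_less_iff)
    then have "w ^ ((nat ((- x) mod int n) + nat x) * c) = 1"
      using primroot_power_eq_iff[OF assms, of "(nat ((- x) mod int n) + nat x) * c" 0] by simp
    then show ?thesis
      using primroot_nonzero[OF assms] by (simp add: distrib_right power_add field_simps power_inverse)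
  qed
  then have "fourier (integer_mod_group n) f (restrict (\<lambda>x. w ^ (nat x * c)) {0..<int n}) =
      (\<Sum>x\<in>{0..<int n}. f x * inverse w ^ (nat x * c))"
    unfolding fourier_def using n by (intro sum.cong) (auto simp: carrier_mod)
  also have "\<dots> = dft n (inverse w) (\<lambda>x. f (int x)) c"
    unfolding dft_def by (rule sum.reindex_bij_witness[of _ int nat]) auto
  finally show ?thesis .
qed

lemma card_supp_integer_mod_group:
  "n > 0 \<Longrightarrow> card (supp (integer_mod_group n) f) = card (nonzeros n (\<lambda>x. f (int x)))"
proof -
  assume "n > 0"
  then have "supp (integer_mod_group n) f = int ` nonzeros n (\<lambda>x. f (int x))"
    by (force simp: supp_def nonzeros_def carrier_mod image_iff intro: exI[of _ "nat _"])
  then show ?thesis by (simp add: card_image)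
qed

lemma supp_integer_mod_group_empty_iff:
  assumes "n > 0"
  shows "supp (integer_mod_group n) f = {} \<longleftrightarrow> nonzeros n (\<lambda>x. f (int x)) = {}"
proof -
  have "finite (supp (integer_mod_group n) f)"
    using assms by (auto simp: supp_def carrier_mod intro: finite_subset[of _ "{0..<int n}"])
  then show ?thesis
    using card_supp_integer_mod_group[OF assms, of f] by (metis card_0_eq finite_nonzeros)
qed

text \<open>Parametrising the characters by \<open>inverse w\<close> cancels the inversion in the
  Fourier transform, which leaves \<open>dft\<close> with \<open>w\<close> itself.\<close>

lemma card_fourier_supp_integer_mod_group:
  assumes "primroot n w"
  shows "card (fourier_supp (integer_mod_group n) f) = card (nonzeros n (dft n w (\<lambda>x. f (int x))))"
proof -
  let ?\<psi> = "\<lambda>c. restrict (\<lambda>x. inverse w ^ (nat x * c)) {0..<int n}"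
  have bij: "bij_betw ?\<psi> {..<n} (characters (integer_mod_group n))"
    by (intro characters_integer_mod_group primroot_inverse assms)
  have f: "fourier (integer_mod_group n) f (?\<psi> c) = dft n w (\<lambda>x. f (int x)) c" for c
    using fourier_integer_mod_group[OF primroot_inverse[OF assms], of f c] by simp
  have "fourier_supp (integer_mod_group n) f = ?\<psi> ` nonzeros n (dft n w (\<lambda>x. f (int x)))"
    unfolding fourier_supp_def bij_betw_imp_surj_on[OF bij, symmetric]
    by (auto simp: nonzeros_def f)
  moreover have "inj_on ?\<psi> (nonzeros n (dft n w (\<lambda>x. f (int x))))"
    using bij_betw_imp_inj_on[OF bij] by (rule inj_on_subset) (auto simp: nonzeros_def)
  ultimately show ?thesis by (simp add: card_image)
qed

subsection \<open>Meshulam's function and its equality cases\<close>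

lemma theta_eqI:
  assumes "\<And>f. supp G f \<noteq> {} \<Longrightarrow> card (supp G f) \<le> k \<Longrightarrow> T \<le> card (fourier_supp G f)"
    and "supp G f \<noteq> {}" "card (supp G f) \<le> k" "card (fourier_supp G f) = T"
  shows "theta k G = enat T"
  unfolding theta_def
proof (rule antisym)
  show "Inf {enat (card (fourier_supp G f)) |f. supp G f \<noteq> {} \<and> card (supp G f) \<le> k} \<le> enat T"
    using assms(2-4) by (intro Inf_lower) blast
  show "enat T \<le> Inf {enat (card (fourier_supp G f)) |f. supp G f \<noteq> {} \<and> card (supp G f) \<le> k}"
  proof (rule Inf_greatest)
    fix y assume "y \<in> {enat (card (fourier_supp G f)) |f. supp G f \<noteq> {} \<and> card (supp G f) \<le> k}"
    then obtain f where "y = enat (card (fourier_supp G f))" "supp G f \<noteq> {}" "card (supp G f) \<le> k"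
      by blast
    then show "enat T \<le> y" using assms(1) by simp
  qed
qed

text \<open>The convention at \<open>k = 0\<close>, needed to compare \<open>k = 1\<close> with its
  predecessor. Finiteness matters because an infinite support would have \<open>card\<close> equal
  to 0.\<close>

lemma theta_0:
  assumes "finite (carrier G)"
  shows "theta 0 G = \<infinity>"
proof -
  have "finite (supp G f)" for f :: "'a \<Rightarrow> complex"
    using assms by (simp add: supp_def)
  then have "{enat (card (fourier_supp G f)) |f. supp G f \<noteq> {} \<and> card (supp G f) \<le> 0} = {}"
    by simp
  then show ?thesis unfolding theta_def by (simp only: Inf_enat_def)  simp
qed

lemma ball_int_iff: "(\<forall>x\<in>{0..<int n}. P x) \<longleftrightarrow> (\<forall>x<n. P (int x))"
proof -
  have "{0..<int n} = int ` {..<n}"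
    by (simp add: image_int_atLeastLessThan lessThan_atLeast0)
  then show ?thesis by auto
qed

text \<open>Carries existence statements between functions on the integer carrier and functions on
  natural indices.\<close>

lemma ex_fun_int_iff: "(\<exists>g :: int \<Rightarrow> complex. P (\<lambda>x :: nat. g (int x))) \<longleftrightarrow> (\<exists>g. P g)"
proof
  assume "\<exists>g. P g"
  then obtain g where "P g" ..
  then have "P (\<lambda>x. (g \<circ> nat) (int x))" by simp
  then show "\<exists>g :: int \<Rightarrow> complex. P (\<lambda>x :: nat. g (int x))" by blast
qed blast

section \<open>The values of Meshulam's function and its equality cases for the group of order
  \<open>p * p\<close>\<close>

context
  fixes p :: nat and w :: complex
  assumes prime: "prime p" and root: "primroot (p * p) w"
begin

private lemma p_pos: "p > 0"
  using prime by (rule prime_gt_0_nat)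

private lemma root_p: "primroot p (w ^ p)"
  using root by (rule primroot_power)

private lemma theta_sq_eqI:
  assumes "\<And>f. nonzeros (p * p) f \<noteq> {} \<Longrightarrow> card (nonzeros (p * p) f) \<le> k \<Longrightarrow>
      T \<le> card (nonzeros (p * p) (dft (p * p) w f))"
    and "nonzeros (p * p) f \<noteq> {}" "card (nonzeros (p * p) f) \<le> k"
      "card (nonzeros (p * p) (dft (p * p) w f)) = T"
  shows "theta k (integer_mod_group (p * p)) = enat T"
proof (rule theta_eqI)
  note simps = card_supp_integer_mod_group supp_integer_mod_group_empty_iff
    card_fourier_supp_integer_mod_group[OF root] p_pos
  show "T \<le> card (fourier_supp (integer_mod_group (p * p)) f)"
    if "supp (integer_mod_group (p * p)) f \<noteq> {}" "card (supp (integer_mod_group (p * p)) f) \<le> k" for f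
    using assms(1) that by (simp add: simps)
  show "supp (integer_mod_group (p * p)) (\<lambda>x. f (nat x)) \<noteq> {}"
    "card (supp (integer_mod_group (p * p)) (\<lambda>x. f (nat x))) \<le> k"
    "card (fourier_supp (integer_mod_group (p * p)) (\<lambda>x. f (nat x))) = T"
    using assms(2-4) by (simp_all add: simps)
qed

private lemma sharp_small:
  assumes "k \<in> {1..p}"
  obtains f where "card (nonzeros (p * p) f) = k"
    "card (nonzeros (p * p) (dft (p * p) w f)) = p * (p - k + 1)"
proof -
  obtain g where g: "card (nonzeros p g) = k" "card (nonzeros p (dft p (w ^ p) g)) = p - k + 1"
    using uncertainty_prime_sharp[OF prime root_p assms] by blast
  \<comment> \<open>An extremal function of the group of order \<open>p\<close>, placed on the coset
    of 0.\<close>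
  let ?f = "\<lambda>x. g (x div p) * (if x mod p = 0 then 1 else 0)"
  have "card (nonzeros (p * p) ?f) = k \<and>
      card (nonzeros (p * p) (dft (p * p) w ?f)) = p * (p - k + 1)"
    unfolding equality_small_iff[OF prime root assms]
    using g p_pos by (intro exI[of _ g] exI[of _ 0]) auto
  then show ?thesis using that by blast
qed

text \<open>The \<open>p\<close>-periodic extension of an extremal function on the group of order
  \<open>p\<close>, with trivial modulation.\<close>

private lemma sharp_large:
  assumes "j \<in> {1..p}"
  obtains f where "card (nonzeros (p * p) f) = p * j"
    "card (nonzeros (p * p) (dft (p * p) w f)) = p - j + 1"
proof -
  obtain g where g: "card (nonzeros p g) = j" "card (nonzeros p (dft p (w ^ p) g)) = p - j + 1"
    using uncertainty_prime_sharp[OF prime root_p assms] by blast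
  have "(\<lambda>x. g (x mod p)) (p * x + b) = w ^ (0 * (p * x + b)) * g b" if "x < p" "b < p" for x b
    using that by simp
  from nonzeros_dft_modulated_periodic[OF p_pos root, of "\<lambda>x. g (x mod p)", OF this] g that
  show ?thesis by auto
qed

private lemma theta_small:
  assumes "k \<in> {1..p}"
  shows "theta k (integer_mod_group (p * p)) = enat (p * (p - k + 1))"
proof -
  obtain f where f: "card (nonzeros (p * p) f) = k"
    "card (nonzeros (p * p) (dft (p * p) w f)) = p * (p - k + 1)"
    using sharp_small[OF assms] by blast
  show ?thesis
  proof (rule theta_sq_eqI)
    fix h assume h: "nonzeros (p * p) h \<noteq> {}" "card (nonzeros (p * p) h) \<le> k"
    have "p * p + p \<le> card (nonzeros (p * p) (dft (p * p) w h)) + p * card (nonzeros (p * p) h)"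
      using meshulam_bound[OF prime root h(1)] .
    moreover have "p * card (nonzeros (p * p) h) \<le> p * k" using h(2) by simp
    moreover have "p * (p - k + 1) + p * k = p * p + p"
      using assms by (simp flip: distrib_left)
    ultimately show "p * (p - k + 1) \<le> card (nonzeros (p * p) (dft (p * p) w h))" by linarith
  qed (use f assms in auto)
qed

text \<open>The dual bound divided by \<open>p\<close> gives the lower estimate, the floor coming
  from integrality. It is attained with support size \<open>p * (k div p)\<close>, the largest
  multiple of \<open>p\<close> up to \<open>k\<close>.\<close>

private lemma theta_large:
  assumes "k \<in> {p..p * p}"
  shows "theta k (integer_mod_group (p * p)) = enat (p - k div p + 1)"
proof -
  have "1 \<le> k div p" using assms p_pos by (simp add: div_greater_zero_iff Suc_le_eq)
  moreover have "k div p \<le> p" using assms p_pos div_le_mono[of k "p * p" p] by simp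
  ultimately have j: "k div p \<in> {1..p}" by simp
  obtain f where f: "card (nonzeros (p * p) f) = p * (k div p)"
    "card (nonzeros (p * p) (dft (p * p) w f)) = p - k div p + 1"
    using sharp_large[OF j] by blast
  show ?thesis
  proof (rule theta_sq_eqI)
    fix h assume h: "nonzeros (p * p) h \<noteq> {}" "card (nonzeros (p * p) h) \<le> k"
    let ?L = "card (nonzeros (p * p) (dft (p * p) w h))"
    have "p * p + p \<le> k + p * ?L"
      using meshulam_bound_dual[OF prime root h(1)] h(2) by linarith
    then have "p * (p + 1) \<le> k + ?L * p" by (simp add: algebra_simps)
    from div_le_mono[OF this, of p] have "p + 1 \<le> k div p + ?L" using p_pos by simp
    then show "p - k div p + 1 \<le> ?L" using j by auto
  next
    show "card (nonzeros (p * p) f) \<le> k" using f by simp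
    show "nonzeros (p * p) f \<noteq> {}" using f(1) j p_pos by auto
  qed (fact f)
qed

private lemma equality_case_iff:
  assumes "1 \<le> k" "theta k (integer_mod_group (p * p)) = enat T"
  shows "equality_case k (integer_mod_group (p * p)) f \<longleftrightarrow>
    card (nonzeros (p * p) (\<lambda>x. f (int x))) = k \<and>
    card (nonzeros (p * p) (dft (p * p) w (\<lambda>x. f (int x)))) = T"
proof -
  have "nonzeros (p * p) (\<lambda>x. f (int x)) \<noteq> {}" if "card (nonzeros (p * p) (\<lambda>x. f (int x))) = k"
    using that assms(1) by auto
  then show ?thesis
    using p_pos
    by (auto simp: equality_case_def card_supp_integer_mod_group supp_integer_mod_group_empty_iff
        card_fourier_supp_integer_mod_group[OF root] assms(2))
qed

private lemma ex_equality_case_iff: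
  assumes "1 \<le> k" "theta k (integer_mod_group (p * p)) = enat T"
  shows "(\<exists>f. equality_case k (integer_mod_group (p * p)) f) \<longleftrightarrow>
    (\<exists>f. card (nonzeros (p * p) f) = k \<and> card (nonzeros (p * p) (dft (p * p) w f)) = T)"
  unfolding equality_case_iff[OF assms]
  by (rule ex_fun_int_iff[of "\<lambda>f. card (nonzeros (p * p) f) = k \<and>
        card (nonzeros (p * p) (dft (p * p) w f)) = T"])

private lemma ex_equality_case_small:
  assumes "k \<in> {1..p}"
  shows "\<exists>f. equality_case k (integer_mod_group (p * p)) f"
proof -
  obtain f where "card (nonzeros (p * p) f) = k \<and>
      card (nonzeros (p * p) (dft (p * p) w f)) = p * (p - k + 1)"
    using sharp_small[OF assms] by blast
  then show ?thesis
    using ex_equality_case_iff[OF _ theta_small[OF assms]] assms by auto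
qed

private lemma ex_equality_case_large:
  assumes "p \<le> k" "k + 1 < p * p"
  shows "(\<exists>f. equality_case k (integer_mod_group (p * p)) f) \<longleftrightarrow> p dvd k"
proof -
  have k: "k \<in> {p..p * p}" "1 \<le> k" using assms p_pos by auto
  have "p dvd k" if "card (nonzeros (p * p) f) = k"
    "card (nonzeros (p * p) (dft (p * p) w f)) = p - k div p + 1" for f
    using equality_large_imp_dvd[OF prime root, of f] that assms by auto
  moreover have "\<exists>f. card (nonzeros (p * p) f) = k \<and>
      card (nonzeros (p * p) (dft (p * p) w f)) = p - k div p + 1" if dvd: "p dvd k"
  proof -
    obtain j where j: "k = p * j" using dvd by blast
    have "j \<in> {1..p}" using k p_pos by (auto simp: j)
    then obtain f where "card (nonzeros (p * p) f) = p * j"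
      "card (nonzeros (p * p) (dft (p * p) w f)) = p - j + 1"
      by (rule sharp_large)
    then show ?thesis using p_pos by (intro exI[of _ f]) (simp add: j)
  qed
  ultimately show ?thesis unfolding ex_equality_case_iff[OF k(2) theta_large[OF k(1)]] by blast
qed

text \<open>Up to \<open>p\<close> the function drops at every step and equality cases always exist.
  Beyond \<open>p\<close> it drops exactly when \<open>k div p\<close> jumps, that is, at the
  multiples of \<open>p\<close>, where the equality cases are.\<close>

private lemma ex_equality_case_iff_theta_less:
  assumes "1 \<le> k" "k + 1 < p * p"
  shows "(\<exists>f. equality_case k (integer_mod_group (p * p)) f) \<longleftrightarrow>
    theta k (integer_mod_group (p * p)) < theta (k - 1) (integer_mod_group (p * p))"
proof (cases "k \<le> p")
  case True
  then have k: "k \<in> {1..p}" using assms by simp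
  have "theta k (integer_mod_group (p * p)) < theta (k - 1) (integer_mod_group (p * p))"
  proof (cases "k = 1")
    case True
    then show ?thesis using theta_small[OF k] p_pos by (simp add: theta_0 carrier_mod)
  next
    case False
    then have k': "k - 1 \<in> {1..p}" using k by auto
    have "p - k + 1 < p - (k - 1) + 1" using k by auto
    then show ?thesis unfolding theta_small[OF k] theta_small[OF k'] using p_pos by simp
  qed
  then show ?thesis using ex_equality_case_small[OF k] by simp
next
  case False
  then have k: "k \<in> {p..p * p}" "k - 1 \<in> {p..p * p}" using assms by auto
  have "k div p \<le> p" using k p_pos div_le_mono[of k "p * p" p] by simp
  obtain m where m: "k = Suc m" using assms by (cases k) auto
  have "k div p = (if p dvd k then Suc (m div p) else m div p)"
    unfolding m by (simp add: div_Suc mod_eq_0_iff_dvd)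
  then have "p - k div p + 1 < p - (k - 1) div p + 1 \<longleftrightarrow> p dvd k"
    using \<open>k div p \<le> p\<close> m by auto
  then show ?thesis
    using ex_equality_case_large[of k] False assms
    unfolding theta_large[OF k(1)] theta_large[OF k(2)] by simp
qed

private lemma equality_case_small:
  assumes "k \<in> {1..p}"
  shows "equality_case k (integer_mod_group (p * p)) f \<longleftrightarrow>
    (\<exists>g. \<exists>a\<in>{0..<int p}.
       card (supp (integer_mod_group p) g) = k \<and>
       card (fourier_supp (integer_mod_group p) g) = p - k + 1 \<and>
       (\<forall>x\<in>{0..<int p}. \<forall>x'\<in>{0..<int p}. f (int p * x + x') = g x * indicator {a} x'))"
proof -
  have bex: "(\<exists>a\<in>{0..<int p}. P a) \<longleftrightarrow> (\<exists>a<p. P (int a))" for P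
    using ball_int_iff[of p "\<lambda>x. \<not> P x"] by blast
  have ind: "(indicator {int a} (int b) :: complex) = (if b = a then 1 else 0)" for a b
    by (simp add: indicator_def)
  have "equality_case k (integer_mod_group (p * p)) f \<longleftrightarrow>
    (\<exists>g a. a < p \<and> card (nonzeros p g) = k \<and> card (nonzeros p (dft p (w ^ p) g)) = p - k + 1 \<and>
      (\<forall>x<p. \<forall>b<p. f (int p * int x + int b) = g x * (if b = a then 1 else 0)))"
    using assms equality_case_iff[OF _ theta_small[OF assms], of f]
      equality_small_iff[OF prime root assms, of "\<lambda>x. f (int x)"] by simp
  also have "\<dots> \<longleftrightarrow> (\<exists>g :: int \<Rightarrow> complex. \<exists>a. a < p \<and> card (nonzeros p (\<lambda>x. g (int x))) = k \<and>
      card (nonzeros p (dft p (w ^ p) (\<lambda>x. g (int x)))) = p - k + 1 \<and>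
      (\<forall>x<p. \<forall>b<p. f (int p * int x + int b) = g (int x) * (if b = a then 1 else 0)))"
    by (rule ex_fun_int_iff[symmetric])
  finally show ?thesis
    unfolding bex ball_int_iff ind card_supp_integer_mod_group[OF p_pos]
      card_fourier_supp_integer_mod_group[OF root_p] .
qed

text \<open>The modulation is a character \<open>\<psi>\<close> of the whole group. It factors into
  \<open>\<psi> (p * x)\<close>, a character of the group of order \<open>p\<close> in
  \<open>x\<close>, and \<open>\<psi> x'\<close>; the condition on the transform concerns
  \<open>g\<close> with the factor \<open>\<psi> x'\<close> removed.\<close>

private lemma equality_case_large:
  assumes "p \<le> p * j" "p * j + 1 < p * p"
  shows "equality_case (p * j) (integer_mod_group (p * p)) f \<longleftrightarrow>
    (\<exists>\<psi>\<in>characters (integer_mod_group (p * p)). \<exists>g.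
       card (supp (integer_mod_group p) g) = j \<and>
       card (fourier_supp (integer_mod_group p) g) = p - j + 1 \<and>
       (\<forall>x\<in>{0..<int p}. \<forall>x'\<in>{0..<int p}.
          f (int p * x + x') = \<psi> (int p * x + x') * g x'))"
proof -
  let ?\<psi> = "\<lambda>c. restrict (\<lambda>x. w ^ (nat x * c)) {0..<int (p * p)}"
  let ?P = "\<lambda>c g. card (nonzeros p g) = j \<and> card (nonzeros p (dft p (w ^ p) g)) = p - j + 1 \<and>
      (\<forall>x<p. \<forall>b<p. f (int p * int x + int b) = w ^ (c * (p * x + b)) * g b)"
  have k: "p * j \<in> {p..p * p}" "1 \<le> p * j"
    using assms p_pos unfolding atLeastAtMost_iff by linarith+
  have th: "theta (p * j) (integer_mod_group (p * p)) = enat (p - j + 1)"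
    using theta_large[OF k(1)] p_pos by simp
  have pow: "w ^ (c mod (p * p) * x) = w ^ (c * x)" for c x
    by (simp add: primroot_power_eq_iff[OF root] mod_mult_left_eq)
  have \<psi>: "?\<psi> c (int p * int x + int b) = w ^ (c * (p * x + b))" if "x < p" "b < p" for c x b
  proof -
    have eq: "int p * int x + int b = int (p * x + b)" by simp
    have "int (p * x + b) \<in> {0..<int (p * p)}"
      using digits_less[OF that] by (simp del: of_nat_add of_nat_mult)
    then show ?thesis unfolding eq by (simp only: restrict_apply' nat_int mult.commute)
  qed
  have "equality_case (p * j) (integer_mod_group (p * p)) f \<longleftrightarrow> (\<exists>g c. ?P c g)"
    using equality_case_iff[OF k(2) th, of f] assms
      equality_large_iff[OF prime root, of j "\<lambda>x. f (int x)"] by simp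
  \<comment> \<open>Frequencies matter only modulo \<open>p * p\<close>, and the reduced ones index
    the characters.\<close>
  also have "\<dots> \<longleftrightarrow> (\<exists>c<p * p. \<exists>g. ?P c g)"
  proof
    assume "\<exists>g c. ?P c g"
    then obtain g c where "?P c g" by blast
    then have "?P (c mod (p * p)) g" by (simp add: pow)
    moreover have "c mod (p * p) < p * p" using p_pos by simp
    ultimately show "\<exists>c<p * p. \<exists>g. ?P c g" by blast
  qed blast
  also have "\<dots> \<longleftrightarrow> (\<exists>c<p * p. \<exists>g :: int \<Rightarrow> complex. ?P c (\<lambda>x. g (int x)))"
    by (simp only: ex_fun_int_iff[of "?P c" for c])
  also have "\<dots> \<longleftrightarrow> (\<exists>\<psi>\<in>?\<psi> ` {..<p * p}. \<exists>g.
       card (supp (integer_mod_group p) g) = j \<and>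
       card (fourier_supp (integer_mod_group p) g) = p - j + 1 \<and>
       (\<forall>x\<in>{0..<int p}. \<forall>x'\<in>{0..<int p}. f (int p * x + x') = \<psi> (int p * x + x') * g x'))"
    using p_pos
    by (simp add: Bex_def ball_int_iff card_supp_integer_mod_group
        card_fourier_supp_integer_mod_group[OF root_p] \<psi> del: restrict_apply of_nat_mult)
  finally show ?thesis
    unfolding bij_betw_imp_surj_on[OF characters_integer_mod_group[OF root]] .
qed

lemmas theta_and_equality_cases = theta_small theta_large ex_equality_case_iff_theta_less
  equality_case_small ex_equality_case_large equality_case_large

end

theorem theorem26:
  fixes p :: nat
  assumes "prime p"
  shows
    "(\<forall>k\<in>{1..p}. theta k (integer_mod_group (p\<^sup>2)) = enat (p * (p - k + 1))) \<and>
     (\<forall>k\<in>{p..p\<^sup>2}. theta k (integer_mod_group (p\<^sup>2)) = enat (p - k div p + 1)) \<and>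
     (\<forall>k. 1 \<le> k \<and> k < p\<^sup>2 - 1 \<longrightarrow>
        ((\<exists>f. equality_case k (integer_mod_group (p\<^sup>2)) f) \<longleftrightarrow>
         theta k (integer_mod_group (p\<^sup>2)) < theta (k - 1) (integer_mod_group (p\<^sup>2)))) \<and>
     (\<forall>k\<in>{1..p}. \<forall>f.
        equality_case k (integer_mod_group (p\<^sup>2)) f \<longleftrightarrow>
        (\<exists>g. \<exists>a\<in>{0..<int p}.
           card (supp (integer_mod_group p) g) = k \<and>
           card (fourier_supp (integer_mod_group p) g) = p - k + 1 \<and>
           (\<forall>x\<in>{0..<int p}. \<forall>x'\<in>{0..<int p}.
              f (int p * x + x') = g x * indicator {a} x'))) \<and>
     (\<forall>k. p \<le> k \<and> k < p\<^sup>2 - 1 \<longrightarrow>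
        ((\<exists>f. equality_case k (integer_mod_group (p\<^sup>2)) f) \<longleftrightarrow> p dvd k)) \<and>
     (\<forall>k j. p \<le> k \<and> k < p\<^sup>2 - 1 \<and> k = p * j \<longrightarrow>
        (\<forall>f. equality_case k (integer_mod_group (p\<^sup>2)) f \<longleftrightarrow>
          (\<exists>\<psi>\<in>characters (integer_mod_group (p\<^sup>2)). \<exists>g.
             card (supp (integer_mod_group p) g) = j \<and>
             card (fourier_supp (integer_mod_group p) g) = p - j + 1 \<and>
             (\<forall>x\<in>{0..<int p}. \<forall>x'\<in>{0..<int p}.
                f (int p * x + x') = \<psi> (int p * x + x') * g x'))))"
proof -
  \<comment> \<open>Any primitive root of unity would serve: the resulting facts do not mention
    it.\<close>
  have "primroot (p * p) (cis (2 * pi / real (p * p)))"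
    using assms by (intro primroot_cis) (simp add: prime_gt_0_nat)
  note facts = theta_and_equality_cases[OF assms this, folded power2_eq_square]
  have less: "k + 1 < p\<^sup>2" if "k < p\<^sup>2 - 1" for k using that by linarith
  show ?thesis
    by (intro conjI allI impI ballI; (elim conjE)?; (hypsubst)?; rule facts; (assumption | erule less)?)
qed

end
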